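(* Let $X$ be a Fréchet space and let $\Gamma:[0,1]\to ck(X)$ be Bochner measurable and Pettis integrable in $ck(X)$. Then for each Lebesgue measurable $E\subseteq[0,1]$, $$(P)\int_E\Gamma(t)dt=\Big\{(P)\int_Ef(t)dt:\ f\text{ a Pettis integrable selection of }\Gamma\Big\}.$$
   Context: $X$ is a Fréchet space with metric $d$ induced by an increasing sufficient sequence of seminorms; $X^*$ its dual. $ck(X)$ (resp. $cb(X)$): nonempty compact (resp. closed bounded) convex subsets; $H$ the Hausdorff metric from $d$. $\sigma(x^*,C)=\sup_{x\in C}\langle x^*,x\rangle$. Bochner measurable: there are simple multifunctions $\sum_j\chi_{A_j}C_j$ ($A_j$ pairwise disjoint measurable, $C_j\in cb(X)$) converging to $\Gamma(t)$ in $H$ for a.e. $t$. Pettis integrable in $ck(X)$: $\sigma(x^*,\Gamma(\cdot))$ Lebesgue integrable for all $x^*$ and for each measurable $E$ there is $(P)\int_E\Gamma\in ck(X)$ with $\sigma(x^*,(P)\int_E\Gamma)=\int_E\sigma(x^*,\Gamma(t))dt$ for all $x^*$. A selection is $f:[0,1]\to X$ with $f(t)\in\Gamma(t)$ a.e.; $f$ is Pettis integrable if $\langle x^*,f\rangle$ is integrable for all $x^*$ and for each measurable $E$ there is $(P)\int_Ef\in X$ with $\langle x^*,(P)\int_Ef\rangle=\int_E\langle x^*,f\rangle dt$ for all $x^*$. *)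

theory Defs
  imports "HOL-Analysis.Analysis"
begin

definition is_seminorm :: "('a::real_vector \<Rightarrow> real) \<Rightarrow> bool" where
  "is_seminorm q \<longleftrightarrow> (\<forall>x y. q (x + y) \<le> q x + q y) \<and> (\<forall>c x. q (c *\<^sub>R x) = \<bar>c\<bar> * q x)"

definition fdist :: "(nat \<Rightarrow> 'a::real_vector \<Rightarrow> real) \<Rightarrow> 'a \<Rightarrow> 'a \<Rightarrow> real" where
  "fdist p x y = (\<Sum>n. (1/2) ^ Suc n * (p n (x - y) / (1 + p n (x - y))))"

definition fconv :: "(nat \<Rightarrow> 'a::real_vector \<Rightarrow> real) \<Rightarrow> (nat \<Rightarrow> 'a) \<Rightarrow> 'a \<Rightarrow> bool" where
  "fconv p s x \<longleftrightarrow> (\<lambda>k. fdist p (s k) x) \<longlonglongrightarrow> 0"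

definition fcauchy :: "(nat \<Rightarrow> 'a::real_vector \<Rightarrow> real) \<Rightarrow> (nat \<Rightarrow> 'a) \<Rightarrow> bool" where
  "fcauchy p s \<longleftrightarrow> (\<forall>e>0. \<exists>N. \<forall>m\<ge>N. \<forall>n\<ge>N. fdist p (s m) (s n) < e)"

definition frechet :: "(nat \<Rightarrow> 'a::real_vector \<Rightarrow> real) \<Rightarrow> bool" where
  "frechet p \<longleftrightarrow> (\<forall>n. is_seminorm (p n))
     \<and> (\<forall>n x. p n x \<le> p (Suc n) x)
     \<and> (\<forall>x. (\<forall>n. p n x = 0) \<longrightarrow> x = 0)
     \<and> (\<forall>s. fcauchy p s \<longrightarrow> (\<exists>x. fconv p s x))"

definition fdual :: "(nat \<Rightarrow> 'a::real_vector \<Rightarrow> real) \<Rightarrow> ('a \<Rightarrow> real) set" where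
  "fdual p = {f. linear f \<and> (\<forall>x. \<forall>e>0. \<exists>\<delta>>0. \<forall>y. fdist p x y < \<delta> \<longrightarrow> \<bar>f y - f x\<bar> < e)}"

definition fclosed :: "(nat \<Rightarrow> 'a::real_vector \<Rightarrow> real) \<Rightarrow> 'a set \<Rightarrow> bool" where
  "fclosed p C \<longleftrightarrow> (\<forall>s x. (\<forall>k. s k \<in> C) \<longrightarrow> fconv p s x \<longrightarrow> x \<in> C)"

definition fcompact :: "(nat \<Rightarrow> 'a::real_vector \<Rightarrow> real) \<Rightarrow> 'a set \<Rightarrow> bool" where
  "fcompact p C \<longleftrightarrow> (\<forall>s. (\<forall>k. s k \<in> C) \<longrightarrow>
      (\<exists>(r::nat\<Rightarrow>nat) x. strict_mono r \<and> x \<in> C \<and> fconv p (s \<circ> r) x))"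

definition fbounded :: "(nat \<Rightarrow> 'a::real_vector \<Rightarrow> real) \<Rightarrow> 'a set \<Rightarrow> bool" where
  "fbounded p C \<longleftrightarrow> (\<forall>n. \<exists>M. \<forall>x\<in>C. p n x \<le> M)"

definition ck :: "(nat \<Rightarrow> 'a::real_vector \<Rightarrow> real) \<Rightarrow> 'a set set" where
  "ck p = {C. C \<noteq> {} \<and> fcompact p C \<and> convex C}"

definition cb :: "(nat \<Rightarrow> 'a::real_vector \<Rightarrow> real) \<Rightarrow> 'a set set" where
  "cb p = {C. C \<noteq> {} \<and> fclosed p C \<and> fbounded p C \<and> convex C}"

definition fhaus :: "(nat \<Rightarrow> 'a::real_vector \<Rightarrow> real) \<Rightarrow> 'a set \<Rightarrow> 'a set \<Rightarrow> real" where
  "fhaus p A B = max (SUP a\<in>A. INF b\<in>B. fdist p a b) (SUP b\<in>B. INF a\<in>A. fdist p a b)"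

definition supp_fun :: "('a \<Rightarrow> real) \<Rightarrow> 'a set \<Rightarrow> real" where
  "supp_fun xs C = (SUP x\<in>C. xs x)"

abbreviation I01 :: "real measure" where
  "I01 \<equiv> lebesgue_on {0..1}"

text \<open>Simple multifunction \<open>\<Sum>j \<chi>_{A_j} C_j\<close>: finitely many pairwise disjoint measurable
  sets \<open>A_j\<close>, with value \<open>C_j\<close> on \<open>A_j\<close> and \<open>{0}\<close> off their union.\<close>
definition simple_mf :: "(nat \<Rightarrow> 'a::real_vector \<Rightarrow> real) \<Rightarrow> (real \<Rightarrow> 'a set) \<Rightarrow> bool" where
  "simple_mf p S \<longleftrightarrow> (\<exists>(m::nat) (A::nat \<Rightarrow> real set) C.
      (\<forall>j<m. A j \<in> sets I01 \<and> C j \<in> cb p)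
    \<and> (\<forall>i<m. \<forall>j<m. i \<noteq> j \<longrightarrow> A i \<inter> A j = {})
    \<and> (\<forall>t\<in>{0..1}. (\<forall>j<m. t \<in> A j \<longrightarrow> S t = C j)
                   \<and> ((\<forall>j<m. t \<notin> A j) \<longrightarrow> S t = {0})))"

definition bochner_meas_mf :: "(nat \<Rightarrow> 'a::real_vector \<Rightarrow> real) \<Rightarrow> (real \<Rightarrow> 'a set) \<Rightarrow> bool" where
  "bochner_meas_mf p \<Gamma> \<longleftrightarrow> (\<exists>S. (\<forall>n. simple_mf p (S n)) \<and>
      (AE t in I01. (\<lambda>n. fhaus p (S n t) (\<Gamma> t)) \<longlonglongrightarrow> 0))"

definition is_pettis_int_mf :: "(nat \<Rightarrow> 'a::real_vector \<Rightarrow> real) \<Rightarrow> (real \<Rightarrow> 'a set) \<Rightarrow> real set \<Rightarrow> 'a set \<Rightarrow> bool" where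
  "is_pettis_int_mf p \<Gamma> E K \<longleftrightarrow> K \<in> ck p \<and>
     (\<forall>xs\<in>fdual p. supp_fun xs K = integral\<^sup>L (lebesgue_on E) (\<lambda>t. supp_fun xs (\<Gamma> t)))"

definition pettis_integrable_mf :: "(nat \<Rightarrow> 'a::real_vector \<Rightarrow> real) \<Rightarrow> (real \<Rightarrow> 'a set) \<Rightarrow> bool" where
  "pettis_integrable_mf p \<Gamma> \<longleftrightarrow>
     (\<forall>xs\<in>fdual p. integrable I01 (\<lambda>t. supp_fun xs (\<Gamma> t)))
   \<and> (\<forall>E\<in>sets I01. \<exists>K. is_pettis_int_mf p \<Gamma> E K)"

definition is_pettis_int :: "(nat \<Rightarrow> 'a::real_vector \<Rightarrow> real) \<Rightarrow> (real \<Rightarrow> 'a) \<Rightarrow> real set \<Rightarrow> 'a \<Rightarrow> bool" where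
  "is_pettis_int p f E y \<longleftrightarrow>
     (\<forall>xs\<in>fdual p. xs y = integral\<^sup>L (lebesgue_on E) (\<lambda>t. xs (f t)))"

definition pettis_integrable :: "(nat \<Rightarrow> 'a::real_vector \<Rightarrow> real) \<Rightarrow> (real \<Rightarrow> 'a) \<Rightarrow> bool" where
  "pettis_integrable p f \<longleftrightarrow>
     (\<forall>xs\<in>fdual p. integrable I01 (\<lambda>t. xs (f t)))
   \<and> (\<forall>E\<in>sets I01. \<exists>y. is_pettis_int p f E y)"

definition selection :: "(real \<Rightarrow> 'a set) \<Rightarrow> (real \<Rightarrow> 'a) \<Rightarrow> bool" where
  "selection \<Gamma> f \<longleftrightarrow> (AE t in I01. f t \<in> \<Gamma> t)"

end

theory Submission
  imports Defs "HOL-Library.Function_Algebras"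
begin

text \<open>If \<open>f\<close> is a Pettis integrable selection with \<open>(P)\<integral>\<^sub>E f = y\<close>, then \<open>x\<^sup>* y \<le> \<sigma>(x\<^sup>*, K)\<close> for every
  \<open>x\<^sup>*\<close>, so \<open>y \<in> K\<close> by Hahn--Banach separation.

  Conversely let \<open>y \<in> K\<close>. On the simple \<open>X\<^sup>*\<close>-valued functions the functional
  \<open>q \<phi> = \<integral> \<sigma>(\<phi> t, \<Gamma> t) dt\<close> is sublinear and \<open>x\<^sup>* y \<le> q (\<chi>\<^sub>E x\<^sup>*)\<close>, so Hahn--Banach gives a linear
  \<open>\<Phi> \<le> q\<close> with \<open>\<Phi> (\<chi>\<^sub>E x\<^sup>*) = x\<^sup>* y\<close>. For fixed \<open>x\<^sup>*\<close> the set function \<open>A \<mapsto> \<Phi> (\<chi>\<^sub>A x\<^sup>*)\<close> has a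
  Radon--Nikodym density. Almost everywhere the densities of countably many functionals are dominated
  by \<open>\<sigma>(\<cdot>, \<Gamma> t)\<close>, and compactness of \<open>\<Gamma> t\<close> yields a point of \<open>\<Gamma> t\<close> at which the functionals take these
  values. Bochner measurability makes the union of almost all \<open>\<Gamma> t\<close> separable, so countably many
  functionals determine the point, and this selection has the densities as its scalarisations.
  Its Pettis integral over \<open>A\<close> exists because \<open>x\<^sup>* \<mapsto> \<Phi> (\<chi>\<^sub>A x\<^sup>*)\<close> is dominated by
  the support function of the compact convex set \<open>(P)\<integral>\<^sub>A \<Gamma>\<close>, hence is evaluation at one of its points.\<close>

section \<open>Sublinear functionals\<close>

definition sublinear_on :: "'v::real_vector set \<Rightarrow> ('v \<Rightarrow> real) \<Rightarrow> bool" where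
  "sublinear_on V q \<longleftrightarrow> (\<forall>x\<in>V. \<forall>y\<in>V. q (x + y) \<le> q x + q y)
     \<and> (\<forall>c\<ge>0. \<forall>x\<in>V. q (c *\<^sub>R x) = c * q x)"

definition linear_on :: "'v::real_vector set \<Rightarrow> ('v \<Rightarrow> real) \<Rightarrow> bool" where
  "linear_on V f \<longleftrightarrow> (\<forall>x\<in>V. \<forall>y\<in>V. f (x + y) = f x + f y) \<and> (\<forall>c. \<forall>x\<in>V. f (c *\<^sub>R x) = c * f x)"

lemma sublinear_on_add: "sublinear_on V q \<Longrightarrow> x \<in> V \<Longrightarrow> y \<in> V \<Longrightarrow> q (x + y) \<le> q x + q y"
  by (simp add: sublinear_on_def)

lemma sublinear_on_scale: "sublinear_on V q \<Longrightarrow> 0 \<le> c \<Longrightarrow> x \<in> V \<Longrightarrow> q (c *\<^sub>R x) = c * q x"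
  by (simp add: sublinear_on_def)

lemma sublinear_on_zero:
  assumes "subspace V" "sublinear_on V q" shows "q 0 = 0"
  using sublinear_on_scale[OF assms(2), of 0 0] subspace_0[OF assms(1)] by simp

lemma sublinear_on_neg:
  assumes "subspace V" "sublinear_on V q" "x \<in> V" shows "- q (- x) \<le> q x"
  using sublinear_on_add[OF assms(2,3) subspace_neg[OF assms(1,3)]] sublinear_on_zero[OF assms(1,2)]
  by simp

text \<open>A linear \<open>F \<le> cone_inf q P\<close> satisfies \<open>F \<le> q\<close> and \<open>F v \<ge> r\<close> for all \<open>(v, r) \<in> P\<close>.\<close>

definition cone_inf :: "('v::real_vector \<Rightarrow> real) \<Rightarrow> ('v \<times> real) set \<Rightarrow> 'v \<Rightarrow> real" where
  "cone_inf q P x = (INF w\<in>P. q (x + fst w) - snd w)"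

text \<open>A pair \<open>(v, r)\<close> in \<open>P\<close> stands for the demand
  \<open>F v \<ge> r\<close>, and \<open>dom\<close> makes each demand compatible with
  \<open>F \<le> q\<close>. That \<open>P\<close> is a cone closed under addition is what makes
  \<open>cone_inf\<close> sublinear.\<close>

locale dominated_cone =
  fixes V :: "'v::real_vector set" and q :: "'v \<Rightarrow> real" and P :: "('v \<times> real) set"
  assumes V: "subspace V" and q: "sublinear_on V q"
    and zero: "0 \<in> P"
    and add: "w \<in> P \<Longrightarrow> w' \<in> P \<Longrightarrow> w + w' \<in> P"
    and scale: "w \<in> P \<Longrightarrow> 0 < c \<Longrightarrow> c *\<^sub>R w \<in> P"
    and mem: "w \<in> P \<Longrightarrow> fst w \<in> V"
    and dom: "w \<in> P \<Longrightarrow> snd w \<le> q (fst w)"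
begin

text \<open>Subadditivity at \<open>(x + fst w) + (- x)\<close>. The bound does not depend on
  \<open>w\<close>, so the infimum in \<open>cone_inf\<close> is finite.\<close>

lemma lower: 
  assumes "x \<in> V" "w \<in> P" shows "- q (- x) \<le> q (x + fst w) - snd w"
proof -
  have "q ((x + fst w) + (- x)) \<le> q (x + fst w) + q (- x)"
    using assms by (intro sublinear_on_add[OF q]) (auto intro: subspace_add subspace_neg V mem)
  then show ?thesis using dom[OF assms(2)] by simp
qed

lemma bdd: "x \<in> V \<Longrightarrow> bdd_below ((\<lambda>w. q (x + fst w) - snd w) ` P)"
  using lower by (intro bdd_belowI2) auto

lemma cone_inf_le: "x \<in> V \<Longrightarrow> w \<in> P \<Longrightarrow> cone_inf q P x \<le> q (x + fst w) - snd w"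
  unfolding cone_inf_def by (rule cINF_lower[OF bdd])

lemma cone_inf_le_self: "x \<in> V \<Longrightarrow> cone_inf q P x \<le> q x"
  using cone_inf_le[OF _ zero] by simp

lemma cone_inf_greatest: "(\<And>w. w \<in> P \<Longrightarrow> m \<le> q (x + fst w) - snd w) \<Longrightarrow> m \<le> cone_inf q P x"
  unfolding cone_inf_def using zero by (intro cINF_greatest) auto

text \<open>If \<open>w\<close> competes in the infimum for \<open>x\<close> and \<open>w'\<close>
  in that for \<open>y\<close>, then \<open>w + w'\<close> competes in the one for
  \<open>x + y\<close>; homogeneity follows in the same way from \<open>scale\<close>.\<close>

lemma sublinear_cone_inf: "sublinear_on V (cone_inf q P)"
  unfolding sublinear_on_def
proof (intro conjI ballI allI impI)
  fix x y assume x: "x \<in> V" and y: "y \<in> V"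
  have *: "cone_inf q P (x + y) - (q (x + fst w) - snd w) \<le> q (y + fst w') - snd w'"
    if w: "w \<in> P" and w': "w' \<in> P" for w w'
  proof -
    have "cone_inf q P (x + y) \<le> q ((x + fst w) + (y + fst w')) - (snd w + snd w')"
      using cone_inf_le[OF subspace_add[OF V x y] add[OF w w']] by (simp add: algebra_simps)
    also have "\<dots> \<le> q (x + fst w) + q (y + fst w') - (snd w + snd w')"
      using x y w w' by (intro diff_right_mono sublinear_on_add[OF q]) (auto intro: subspace_add V mem)
    finally show ?thesis by simp
  qed
  have "cone_inf q P (x + y) - cone_inf q P y \<le> q (x + fst w) - snd w" if "w \<in> P" for w
    using cone_inf_greatest[of "cone_inf q P (x + y) - (q (x + fst w) - snd w)" y] *[OF that] by simp
  then show "cone_inf q P (x + y) \<le> cone_inf q P x + cone_inf q P y"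
    using cone_inf_greatest[of "cone_inf q P (x + y) - cone_inf q P y" x] by simp
next
  have le: "cone_inf q P (c *\<^sub>R x) \<le> c * cone_inf q P x" if c: "0 < c" and x: "x \<in> V" for c x
  proof -
    have "cone_inf q P (c *\<^sub>R x) / c \<le> q (x + fst w) - snd w" if w: "w \<in> P" for w
    proof -
      have "cone_inf q P (c *\<^sub>R x) \<le> q (c *\<^sub>R (x + fst w)) - c * snd w"
        using cone_inf_le[OF subspace_scale[OF V x] scale[OF w c], of c] by (simp add: algebra_simps)
      also have "\<dots> = c * (q (x + fst w) - snd w)"
        using sublinear_on_scale[OF q, of c "x + fst w"] c x mem[OF w]
        by (simp add: subspace_add V right_diff_distrib)
      finally show ?thesis using c by (simp add: field_simps)
    qed
    then have "cone_inf q P (c *\<^sub>R x) / c \<le> cone_inf q P x" by (rule cone_inf_greatest)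
    then show ?thesis using c by (simp add: field_simps)
  qed
  fix c :: real and x assume c: "0 \<le> c" and x: "x \<in> V"
  show "cone_inf q P (c *\<^sub>R x) = c * cone_inf q P x"
  proof (cases "c = 0")
    case True
    \<comment> \<open>In the degenerate case \<open>c = 0\<close> the bound from below at
      \<open>0\<close> is \<open>dom\<close> itself.\<close>
    have "cone_inf q P 0 \<le> 0" using cone_inf_le_self[OF subspace_0[OF V]] sublinear_on_zero[OF V q] by simp
    moreover have "0 \<le> cone_inf q P 0" by (rule cone_inf_greatest) (use dom in auto)
    ultimately show ?thesis using True by simp
  next
    case False
    then have "0 < c" using c by simp
    \<comment> \<open>The reverse inequality is \<open>le\<close> for the factor
      \<open>inverse c\<close> at the point \<open>c *\<^sub>R x\<close>.\<close>
    have "cone_inf q P (inverse c *\<^sub>R (c *\<^sub>R x)) \<le> inverse c * cone_inf q P (c *\<^sub>R x)"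
      using \<open>0 < c\<close> x by (intro le) (auto intro: subspace_scale V)
    then have "c * cone_inf q P x \<le> cone_inf q P (c *\<^sub>R x)"
      using \<open>0 < c\<close> by (simp add: field_simps)
    with le[OF \<open>0 < c\<close> x] show ?thesis by simp
  qed
qed

end

text \<open>Imposing the demands on the ray through \<open>(v, q v)\<close> gives a sublinear
  functional below \<open>q\<close>, so minimality forces equality. At \<open>- v\<close> this
  yields \<open>q (- v) \<le> - q v\<close>, and an odd sublinear functional is linear.\<close>

lemma minimal_sublinear_is_linear:
  assumes V: "subspace V" and q: "sublinear_on V q"
    and min: "\<And>q' x. sublinear_on V q' \<Longrightarrow> (\<And>y. y \<in> V \<Longrightarrow> q' y \<le> q y) \<Longrightarrow> x \<in> V \<Longrightarrow> q' x = q x"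
  shows "linear_on V q"
proof -
  have odd: "q (- v) = - q v" if v: "v \<in> V" for v
  proof -
    let ?P = "{(s *\<^sub>R v, s * q v) | s. 0 \<le> s}"
    interpret dominated_cone V q ?P
    proof
      show "subspace V" "sublinear_on V q" by fact+
      show "0 \<in> ?P" by (auto simp: zero_prod_def intro!: exI[of _ 0])
      show "w + w' \<in> ?P" if "w \<in> ?P" "w' \<in> ?P" for w w'
      proof -
        from that obtain s s' where "w = (s *\<^sub>R v, s * q v)" "w' = (s' *\<^sub>R v, s' * q v)" "0 \<le> s" "0 \<le> s'"
          by auto
        then show ?thesis by (auto simp: algebra_simps intro!: exI[of _ "s + s'"])
      qed
      show "c *\<^sub>R w \<in> ?P" if "w \<in> ?P" "0 < c" for w c
      proof -
        from that obtain s where "w = (s *\<^sub>R v, s * q v)" "0 \<le> s" by auto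
        then show ?thesis using \<open>0 < c\<close> by (auto intro!: exI[of _ "c * s"])
      qed
      show "fst w \<in> V" if "w \<in> ?P" for w using that v by (auto simp: subspace_scale[OF V])
      show "snd w \<le> q (fst w)" if "w \<in> ?P" for w
        using that v by (auto simp: sublinear_on_scale[OF q])
    qed
    have "cone_inf q ?P (- v) = q (- v)"
      using v by (intro min sublinear_cone_inf cone_inf_le_self) (auto intro: subspace_neg V)
    moreover have "cone_inf q ?P (- v) \<le> q (- v + fst (v, q v)) - snd (v, q v)"
      using v by (intro cone_inf_le) (auto intro: subspace_neg V intro!: exI[of _ 1])
    ultimately have "q (- v) \<le> - q v" using sublinear_on_zero[OF V q] by simp
    with sublinear_on_neg[OF V q v] show ?thesis by simp
  qed
  show ?thesis unfolding linear_on_def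
  proof (intro conjI ballI allI)
    fix x y assume x: "x \<in> V" and y: "y \<in> V"
    have "q ((x + y) + (- y)) \<le> q (x + y) + q (- y)"
      using x y by (intro sublinear_on_add[OF q]) (auto intro: subspace_add subspace_neg V)
    then have "q x + q y \<le> q (x + y)" using odd[OF y] by simp
    with sublinear_on_add[OF q x y] show "q (x + y) = q x + q y" by simp
  next
    fix c x assume x: "x \<in> V"
    show "q (c *\<^sub>R x) = c * q x"
    proof (cases "0 \<le> c")
      case True then show ?thesis using sublinear_on_scale[OF q _ x] by simp
    next
      case False
      then have "q ((- c) *\<^sub>R x) = (- c) * q x" using sublinear_on_scale[OF q _ x, of "- c"] by simp
      moreover have "q (- (c *\<^sub>R x)) = - q (c *\<^sub>R x)" using x by (intro odd subspace_scale V)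
      ultimately show ?thesis by simp
    qed
  qed
qed

text \<open>Zorn's lemma for the reversed pointwise order; the pointwise infimum of a nonempty chain
  is the bound.\<close>

lemma exists_minimal_sublinear:
  assumes V: "subspace V" and q0: "sublinear_on V q0"
  obtains q where "sublinear_on V q" "\<And>x. x \<in> V \<Longrightarrow> q x \<le> q0 x"
    "\<And>q' x. sublinear_on V q' \<Longrightarrow> (\<And>y. y \<in> V \<Longrightarrow> q' y \<le> q y) \<Longrightarrow> x \<in> V \<Longrightarrow> q' x = q x"
proof -
  \<comment> \<open>Values off \<open>V\<close> are pinned to \<open>q0\<close>. The order on
    functions then compares only the behaviour on \<open>V\<close>, and minimality on
    \<open>V\<close> becomes equality of functions.\<close>
  define A where "A = {q. sublinear_on V q \<and> (\<forall>x\<in>V. q x \<le> q0 x) \<and> (\<forall>x. x \<notin> V \<longrightarrow> q x = q0 x)}"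
  have q0A: "q0 \<in> A" using q0 by (simp add: A_def)
  have "\<exists>m\<in>A. \<forall>a\<in>A. a \<le> m \<longrightarrow> a = m"
  proof (rule predicate_Zorn[where P = "\<lambda>a b. b \<le> a"])
    show "partial_order_on A (relation_of (\<lambda>a b. b \<le> a) A)"
      by (rule partial_order_on_relation_ofI) auto
  next
    fix C assume "C \<in> Chains (relation_of (\<lambda>a b. b \<le> a) A)"
    then have CA: "C \<subseteq> A" and chain: "\<And>a b. a \<in> C \<Longrightarrow> b \<in> C \<Longrightarrow> b \<le> a \<or> a \<le> b"
      unfolding Chains_def relation_of_def by auto
    show "\<exists>u\<in>A. \<forall>a\<in>C. u \<le> a"
    proof (cases "C = {}")
      case True with q0A show ?thesis by auto
    next
      case False
      define u where "u x = (if x \<in> V then INF a\<in>C. a x else q0 x)" for x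
      \<comment> \<open>The bound \<open>- q0 (- x)\<close> serves all members of the chain at
        once.\<close>
      have bdd: "bdd_below ((\<lambda>a. a x) ` C)" if x: "x \<in> V" for x
      proof (rule bdd_belowI2)
        fix a assume "a \<in> C"
        then have a: "sublinear_on V a" "\<forall>x\<in>V. a x \<le> q0 x" using CA by (auto simp: A_def)
        show "- q0 (- x) \<le> a x"
          using sublinear_on_neg[OF V a(1) x] a(2) subspace_neg[OF V x] by fastforce
      qed
      have le: "u x \<le> a x" if "x \<in> V" "a \<in> C" for x a
        using that by (auto simp: u_def intro: cINF_lower bdd)
      have ge: "m \<le> u x" if "x \<in> V" "\<And>a. a \<in> C \<Longrightarrow> m \<le> a x" for x m
        using that False by (auto simp: u_def intro: cINF_greatest)
      have "sublinear_on V u" unfolding sublinear_on_def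
      proof (intro conjI ballI allI impI)
        fix x y assume x: "x \<in> V" and y: "y \<in> V"
        have xy: "x + y \<in> V" using x y V by (rule_tac subspace_add)
        \<comment> \<open>Subadditivity is available only within one functional; of two members of
          the chain the smaller one serves for both terms.\<close>
        have *: "u (x + y) - a x \<le> b y" if a: "a \<in> C" and b: "b \<in> C" for a b
        proof -
          have sa: "a (x + y) \<le> a x + a y" and sb: "b (x + y) \<le> b x + b y"
            using a b CA x y by (auto simp: A_def sublinear_on_add)
          from chain[OF a b] show ?thesis
          proof
            assume "b \<le> a" then have "b x \<le> a x" by (simp add: le_fun_def)
            then show ?thesis using le[OF xy b] sb by linarith
          next
            assume "a \<le> b" then have "a y \<le> b y" by (simp add: le_fun_def)
            then show ?thesis using le[OF xy a] sa by linarith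
          qed
        qed
        have "u (x + y) - u y \<le> a x" if "a \<in> C" for a
          using ge[OF y, of "u (x + y) - a x"] *[OF that] by simp
        then show "u (x + y) \<le> u x + u y" using ge[OF x, of "u (x + y) - u y"] by simp
      next
        fix c x assume c: "(0::real) \<le> c" and x: "x \<in> V"
        have cx: "c *\<^sub>R x \<in> V" using x V by (rule_tac subspace_scale)
        have a: "a (c *\<^sub>R x) = c * a x" if "a \<in> C" for a
          using that CA x c by (auto simp: A_def sublinear_on_scale)
        show "u (c *\<^sub>R x) = c * u x"
        proof (cases "c = 0")
          case True
          have "(INF a\<in>C. a (c *\<^sub>R x)) = (INF a\<in>C. 0)" using a True by (intro INF_cong) auto
          then show ?thesis using True cx False by (simp add: u_def)
        next
          case False
          with c have c: "0 < c" by simp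
          show ?thesis
          proof (rule antisym)
            have "u (c *\<^sub>R x) / c \<le> u x"
              using c by (intro ge[OF x]) (use le[OF cx] a in \<open>simp add: field_simps\<close>)
            then show "u (c *\<^sub>R x) \<le> c * u x" using c by (simp add: field_simps)
            show "c * u x \<le> u (c *\<^sub>R x)"
              using c le[OF x] by (intro ge[OF cx]) (simp add: a)
          qed
        qed
      qed
      moreover have "\<forall>x\<in>V. u x \<le> q0 x"
      proof
        fix x assume x: "x \<in> V"
        obtain a where a: "a \<in> C" using False by auto
        then have "a x \<le> q0 x" using x CA by (auto simp: A_def)
        with le[OF x a] show "u x \<le> q0 x" by simp
      qed
      ultimately have "u \<in> A" by (auto simp: A_def u_def)
      moreover have "u \<le> a" if "a \<in> C" for a
      proof (rule le_funI)
        fix x show "u x \<le> a x"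
          using le[of x a] that CA by (cases "x \<in> V") (auto simp: u_def A_def)
      qed
      ultimately show ?thesis by auto
    qed
  qed
  then obtain m where m: "m \<in> A" "\<And>a. a \<in> A \<Longrightarrow> a \<le> m \<Longrightarrow> a = m" by auto
  show ?thesis
  proof
    show "sublinear_on V m" "\<And>x. x \<in> V \<Longrightarrow> m x \<le> q0 x" using m(1) by (auto simp: A_def)
    fix q' x assume q': "sublinear_on V q'" and le: "\<And>y. y \<in> V \<Longrightarrow> q' y \<le> m y" and x: "x \<in> V"
    define a where "a y = (if y \<in> V then q' y else q0 y)" for y
    have "sublinear_on V a"
      using q' V by (auto simp: sublinear_on_def a_def subspace_add subspace_scale)
    moreover have "\<forall>x\<in>V. a x \<le> q0 x"
      using le m(1) by (auto simp: a_def A_def intro: order_trans)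
    ultimately have "a \<in> A" by (auto simp: A_def a_def)
    moreover have "a \<le> m" using le m(1) by (auto simp: le_fun_def a_def A_def)
    ultimately have "a = m" by (rule m(2))
    then show "q' x = m x" using x by (simp flip: \<open>a = m\<close> add: a_def)
  qed
qed

text \<open>A minimal sublinear functional below \<open>cone_inf q P\<close> is linear. It meets the
  demand \<open>w\<close> because at \<open>- fst w\<close> the competitor \<open>w\<close> itself
  gives the bound \<open>q 0 - snd w\<close>.\<close>

lemma (in dominated_cone) Mazur_Orlicz:
  obtains F where "linear_on V F" "\<And>x. x \<in> V \<Longrightarrow> F x \<le> q x" "\<And>w. w \<in> P \<Longrightarrow> snd w \<le> F (fst w)"
proof -
  obtain F where F: "sublinear_on V F" "\<And>x. x \<in> V \<Longrightarrow> F x \<le> cone_inf q P x"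
    and min: "\<And>q' x. sublinear_on V q' \<Longrightarrow> (\<And>y. y \<in> V \<Longrightarrow> q' y \<le> F y) \<Longrightarrow> x \<in> V \<Longrightarrow> q' x = F x"
    by (rule exists_minimal_sublinear[OF V sublinear_cone_inf]) blast
  have lin: "linear_on V F" using V F(1) min by (rule minimal_sublinear_is_linear)
  have "F x \<le> q x" if "x \<in> V" for x
    using F(2)[OF that] cone_inf_le_self[OF that] by linarith
  moreover have "snd w \<le> F (fst w)" if w: "w \<in> P" for w
  proof -
    have "F (- fst w) \<le> - snd w"
      using F(2)[of "- fst w"] cone_inf_le[of "- fst w", OF _ w] sublinear_on_zero[OF V q] mem[OF w]
      by (simp add: subspace_neg V)
    moreover have "F ((- 1) *\<^sub>R fst w) = (- 1) * F (fst w)"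
      using lin mem[OF w] unfolding linear_on_def by blast
    ultimately show ?thesis by simp
  qed
  ultimately show ?thesis using that lin by blast
qed

section \<open>Compact convex sets and their support functionals\<close>

text \<open>With pointwise operations, functionals on \<open>'a\<close> and functional-valued
  functions of \<open>t\<close> are both vectors, so \<open>subspace\<close> and
  \<open>linear_on\<close> apply to either.\<close>

instantiation "fun" :: (type, real_vector) real_vector
begin

definition scaleR_fun_def: "c *\<^sub>R f = (\<lambda>x. c *\<^sub>R f x)"

instance
  by standard (simp_all add: scaleR_fun_def fun_eq_iff scaleR_add_right scaleR_add_left)

end

lemma scaleR_fun_apply [simp]: "(c *\<^sub>R f) x = c *\<^sub>R f x"
  by (simp add: scaleR_fun_def)

locale frechet_seminorms =
  fixes p :: "nat \<Rightarrow> 'a::real_vector \<Rightarrow> real"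
  assumes frechet: "frechet p"
begin

section \<open>Seminorms and the metric they induce\<close>

lemma seminorm: "is_seminorm (p n)"
  by (rule frechet[unfolded frechet_def, THEN conjunct1, THEN spec])

lemma p_add: "p n (x + y) \<le> p n x + p n y"
  and p_scale: "p n (c *\<^sub>R x) = \<bar>c\<bar> * p n x"
  using seminorm unfolding is_seminorm_def by auto

lemma p_zero [simp]: "p n 0 = 0"
  using p_scale[of n 0 0] by simp

lemma p_neg [simp]: "p n (- x) = p n x"
  using p_scale[of n "-1" x] by simp

lemma p_minus_commute: "p n (x - y) = p n (y - x)"
  using p_neg[of n "x - y"] by simp

lemma p_nonneg [simp]: "0 \<le> p n x"
  using p_add[of n x "- x"] by simp

lemma p_triangle: "p n (x - z) \<le> p n (x - y) + p n (y - z)"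
  using p_add[of n "x - y" "y - z"] by simp

lemma p_Suc: "p n x \<le> p (Suc n) x"
  by (rule frechet[unfolded frechet_def, THEN conjunct2, THEN conjunct1, THEN spec, THEN spec])

lemma p_mono: "m \<le> n \<Longrightarrow> p m x \<le> p n x"
  by (rule lift_Suc_mono_le[where f = "\<lambda>n. p n x"]) (rule p_Suc)

lemma p_separates: "(\<And>n. p n x = 0) \<Longrightarrow> x = 0"
  by (rule frechet[unfolded frechet_def, THEN conjunct2, THEN conjunct2, THEN conjunct1, THEN spec, THEN mp]) blast

lemma sublinear_p: "sublinear_on UNIV (p n)"
  by (auto simp: sublinear_on_def p_add p_scale)

lemma fdist_term_le: "(1/2) ^ Suc n * (p n x / (1 + p n x)) \<le> (1/2) ^ Suc n"
proof -
  have "p n x / (1 + p n x) \<le> 1" using p_nonneg[of n x] by (simp add: add_pos_nonneg)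
  then have "(1/2) ^ Suc n * (p n x / (1 + p n x)) \<le> (1/2) ^ Suc n * 1" by (intro mult_left_mono) auto
  then show ?thesis by simp
qed

lemma fdist_term_nonneg: "0 \<le> (1/2) ^ Suc n * (p n x / (1 + p n x))"
  by simp

lemma summable_fdist: "summable (\<lambda>n. (1/2) ^ Suc n * (p n (x - y) / (1 + p n (x - y))))"
proof (rule summable_comparison_test')
  show "summable (\<lambda>n. (1/2 :: real) ^ Suc n)" using power_half_series by (rule sums_summable)
  show "norm ((1/2) ^ Suc n * (p n (x - y) / (1 + p n (x - y)))) \<le> (1/2) ^ Suc n" for n
    using fdist_term_le[of n "x - y"] fdist_term_nonneg[of n "x - y"] by simp
qed

lemma fdist_nonneg [simp]: "0 \<le> fdist p x y"
  unfolding fdist_def by (intro suminf_nonneg summable_fdist fdist_term_nonneg)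

lemma fdist_le_1: "fdist p x y \<le> 1"
proof -
  have "fdist p x y \<le> (\<Sum>n. (1/2 :: real) ^ Suc n)"
    unfolding fdist_def using power_half_series
    by (intro suminf_le summable_fdist fdist_term_le) (rule sums_summable)
  then show ?thesis using power_half_series by (simp add: sums_iff)
qed

lemma fdist_commute: "fdist p x y = fdist p y x"
  unfolding fdist_def by (simp add: p_minus_commute[of _ x y])

lemma seminorm_small_if_fdist_small:
  assumes "0 < e"
  obtains d where "0 < d" "\<And>x y. fdist p x y < d \<Longrightarrow> p n (x - y) < e"
proof
  \<comment> \<open>The threshold is the \<open>n\<close>-th term of the series with
    \<open>e\<close> in place of the seminorm: one term is at most the whole sum, and
    \<open>t / (1 + t)\<close> is increasing in \<open>t \<ge> 0\<close>.\<close>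
  show "0 < (1/2) ^ Suc n * (e / (1 + e))" using assms by simp
  fix x y assume lt: "fdist p x y < (1/2) ^ Suc n * (e / (1 + e))"
  have "(1/2) ^ Suc n * (p n (x - y) / (1 + p n (x - y))) 
      = sum (\<lambda>n. (1/2) ^ Suc n * (p n (x - y) / (1 + p n (x - y)))) {n}" by simp
  also have "\<dots> \<le> fdist p x y"
    unfolding fdist_def by (rule sum_le_suminf[OF summable_fdist]) (auto simp: fdist_term_nonneg)
  finally have "(1/2) ^ Suc n * (p n (x - y) / (1 + p n (x - y))) < (1/2) ^ Suc n * (e / (1 + e))"
    using lt by linarith
  then have "p n (x - y) / (1 + p n (x - y)) < e / (1 + e)"
    by (rule mult_left_less_imp_less) simp
  then show "p n (x - y) < e"
    using assms p_nonneg[of n "x - y"] by (simp add: divide_simps algebra_simps split: if_splits)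
qed

lemma fconv_seminorm:
  assumes "fconv p s x" shows "(\<lambda>k. p n (s k - x)) \<longlonglongrightarrow> 0"
proof (rule LIMSEQ_I)
  fix e :: real assume "0 < e"
  then obtain d where d: "0 < d" "\<And>x y. fdist p x y < d \<Longrightarrow> p n (x - y) < e"
    by (rule seminorm_small_if_fdist_small[where n = n]) blast
  obtain N where "\<And>k. k \<ge> N \<Longrightarrow> fdist p (s k) x < d"
    using LIMSEQ_D[OF assms[unfolded fconv_def] d(1)] by auto
  then show "\<exists>N. \<forall>k\<ge>N. norm (p n (s k - x) - 0) < e" using d(2) by auto
qed

section \<open>The continuous dual\<close>

lemma dualI:
  assumes f: "linear f" and le: "\<And>x. f x \<le> p n x" shows "f \<in> fdual p"
proof -
  have abs: "\<bar>f x\<bar> \<le> p n x" for x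
    using le[of x] le[of "- x"] linear_neg[OF f, of x] by simp
  have "\<exists>d>0. \<forall>y. fdist p x y < d \<longrightarrow> \<bar>f y - f x\<bar> < e" if e: "0 < e" for x e
  proof -
    obtain d where d: "0 < d" "\<And>x y. fdist p x y < d \<Longrightarrow> p n (x - y) < e"
      using e by (rule seminorm_small_if_fdist_small[where n = n]) blast
    have "\<bar>f y - f x\<bar> < e" if "fdist p x y < d" for y
      using d(2)[OF that] abs[of "x - y"] by (simp add: linear_diff[OF f] abs_minus_commute)
    then show ?thesis using d(1) by blast
  qed
  then show ?thesis using f by (simp add: fdual_def)
qed

lemma dual_continuous:
  assumes "f \<in> fdual p" "0 < e"
  obtains d where "0 < d" "\<And>y. fdist p x y < d \<Longrightarrow> \<bar>f y - f x\<bar> < e"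
  using assms unfolding fdual_def by blast

lemma dual_linear: "f \<in> fdual p \<Longrightarrow> linear f"
  by (simp add: fdual_def)

lemma dual_tendsto:
  assumes f: "f \<in> fdual p" and s: "fconv p s x" shows "(\<lambda>k. f (s k)) \<longlonglongrightarrow> f x"
proof (rule LIMSEQ_I)
  fix e :: real assume "0 < e"
  with f obtain d where d: "0 < d" "\<And>y. fdist p x y < d \<Longrightarrow> \<bar>f y - f x\<bar> < e"
    by (rule dual_continuous[where x = x]) blast
  obtain N where "\<And>k. k \<ge> N \<Longrightarrow> fdist p (s k) x < d"
    using LIMSEQ_D[OF s[unfolded fconv_def] d(1)] by auto
  then have "norm (f (s k) - f x) < e" if "k \<ge> N" for k
    using d(2)[of "s k"] that by (simp add: fdist_commute[of x])
  then show "\<exists>N. \<forall>k\<ge>N. norm (f (s k) - f x) < e" by blast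
qed

lemma subspace_fdual: "subspace (fdual p)"
proof (rule subspaceI)
  show "0 \<in> fdual p" by (rule dualI[of _ 0]) (auto intro!: linearI)
next
  fix f g assume fg: "f \<in> fdual p" "g \<in> fdual p"
  have "\<exists>d>0. \<forall>y. fdist p x y < d \<longrightarrow> \<bar>(f + g) y - (f + g) x\<bar> < e" if e: "0 < e" for x e
  proof -
    from e have "0 < e / 2" by simp
    obtain d1 where d1: "0 < d1" "\<And>y. fdist p x y < d1 \<Longrightarrow> \<bar>f y - f x\<bar> < e / 2"
      using fg(1) \<open>0 < e / 2\<close> by (rule dual_continuous[where x = x]) blast
    obtain d2 where d2: "0 < d2" "\<And>y. fdist p x y < d2 \<Longrightarrow> \<bar>g y - g x\<bar> < e / 2"
      using fg(2) \<open>0 < e / 2\<close> by (rule dual_continuous[where x = x]) blast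
    have "\<bar>(f + g) y - (f + g) x\<bar> < e" if "fdist p x y < min d1 d2" for y
      using d1(2)[of y] d2(2)[of y] that unfolding plus_fun_apply by linarith
    then show ?thesis using d1(1) d2(1) by (intro exI[of _ "min d1 d2"]) auto
  qed
  moreover have "linear (f + g)"
    using linear_compose_add[OF fg[THEN dual_linear]] by (simp add: plus_fun_def)
  ultimately show "f + g \<in> fdual p" by (simp add: fdual_def)
next
  fix c :: real and f assume f: "f \<in> fdual p"
  have "\<exists>d>0. \<forall>y. fdist p x y < d \<longrightarrow> \<bar>(c *\<^sub>R f) y - (c *\<^sub>R f) x\<bar> < e" if e: "0 < e" for x e
  proof -
    \<comment> \<open>The denominator \<open>1 + \<bar>c\<bar>\<close> covers \<open>c = 0\<close>
      as well.\<close>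
    from e have "0 < e / (1 + \<bar>c\<bar>)" by (simp add: add_pos_nonneg)
    with f obtain d where d: "0 < d" "\<And>y. fdist p x y < d \<Longrightarrow> \<bar>f y - f x\<bar> < e / (1 + \<bar>c\<bar>)"
      by (rule dual_continuous[where x = x]) blast
    have "\<bar>(c *\<^sub>R f) y - (c *\<^sub>R f) x\<bar> < e" if "fdist p x y < d" for y
    proof -
      have "\<bar>(c *\<^sub>R f) y - (c *\<^sub>R f) x\<bar> = \<bar>c\<bar> * \<bar>f y - f x\<bar>"
        by (simp flip: right_diff_distrib abs_mult)
      also have "\<dots> \<le> (1 + \<bar>c\<bar>) * \<bar>f y - f x\<bar>" by (intro mult_right_mono) auto
      also have "\<dots> < e" using d(2)[OF that] by (simp add: field_simps add_pos_nonneg)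
      finally show ?thesis .
    qed
    then show ?thesis using d(1) by blast
  qed
  moreover have "linear (c *\<^sub>R f)"
    using linear_compose_scale_right[OF dual_linear[OF f], of c] by (simp add: scaleR_fun_def)
  ultimately show "c *\<^sub>R f \<in> fdual p" by (simp add: fdual_def)
qed

text \<open>Mazur-Orlicz for \<open>p n\<close> with the ray through \<open>(w, p n w)\<close>: at
  \<open>w\<close> the demand and the domination by \<open>p n\<close> meet.\<close>

lemma norming_functional:
  obtains f where "f \<in> fdual p" "f w = p n w" "\<And>x. \<bar>f x\<bar> \<le> p n x"
proof -
  let ?P = "{(s *\<^sub>R w, s * p n w) | s. 0 \<le> s}"
  interpret dominated_cone UNIV "p n" ?P
  proof
    show "0 \<in> ?P" by (auto simp: zero_prod_def intro!: exI[of _ 0])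
    show "v + v' \<in> ?P" if "v \<in> ?P" "v' \<in> ?P" for v v'
    proof -
      from that obtain s s' where "v = (s *\<^sub>R w, s * p n w)" "v' = (s' *\<^sub>R w, s' * p n w)" "0 \<le> s" "0 \<le> s'"
        by auto
      then show ?thesis by (auto simp: algebra_simps intro!: exI[of _ "s + s'"])
    qed
    show "c *\<^sub>R v \<in> ?P" if "v \<in> ?P" "0 < c" for v c
    proof -
      from that obtain s where "v = (s *\<^sub>R w, s * p n w)" "0 \<le> s" by auto
      then show ?thesis using \<open>0 < c\<close> by (auto intro!: exI[of _ "c * s"])
    qed
  qed (auto simp: sublinear_p p_scale)
  obtain f where f: "linear_on UNIV f" "\<And>x. f x \<le> p n x" "\<And>v. v \<in> ?P \<Longrightarrow> snd v \<le> f (fst v)"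
    by (rule Mazur_Orlicz) auto
  then have lin: "linear f" by (auto simp: linear_on_def intro!: linearI)
  show ?thesis
  proof
    show "f \<in> fdual p" using lin f(2) by (rule dualI)
    have "(w, p n w) \<in> ?P" by (auto intro!: exI[of _ 1])
    from f(3)[OF this] show "f w = p n w" using f(2)[of w] by simp
    show "\<bar>f x\<bar> \<le> p n x" for x
      using f(2)[of x] f(2)[of "- x"] linear_neg[OF lin, of x] by simp
  qed
qed

section \<open>Compact convex sets, support functions and separation of points\<close>

lemma convergent_subsequence:
  assumes "fcompact p C" "\<And>k. s k \<in> C"
  obtains r x where "strict_mono (r :: nat \<Rightarrow> nat)" "x \<in> C" "fconv p (s \<circ> r) x"
  using assms(1)[unfolded fcompact_def, rule_format, of s] assms(2) by blast

text \<open>Compactness in \<open>'a\<close> is given sequentially through \<open>p\<close>, so a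
  sequence of values is pulled back to \<open>C\<close>.\<close>

lemma compact_image:
  fixes F :: "'a \<Rightarrow> real"
  assumes C: "fcompact p C" and F: "\<And>s x. fconv p s x \<Longrightarrow> (\<lambda>k. F (s k)) \<longlonglongrightarrow> F x"
  shows "compact (F ` C)"
  unfolding compact_eq_seq_compact_metric
proof (rule seq_compactI)
  fix u :: "nat \<Rightarrow> real" assume "\<forall>k. u k \<in> F ` C"
  then have "\<forall>k. \<exists>x. x \<in> C \<and> u k = F x" by auto
  then obtain s where s: "\<And>k. s k \<in> C" "\<And>k. u k = F (s k)" by metis
  obtain r x where r: "strict_mono r" "x \<in> C" "fconv p (s \<circ> r) x"
    using C s(1) by (rule convergent_subsequence)
  have "(u \<circ> r) \<longlonglongrightarrow> F x"
    using F[OF r(3)] s(2) by (simp add: comp_def)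
  with r show "\<exists>l\<in>F ` C. \<exists>r. strict_mono r \<and> (u \<circ> r) \<longlonglongrightarrow> l" by blast
qed

lemma compact_dual_image: "C \<in> ck p \<Longrightarrow> f \<in> fdual p \<Longrightarrow> compact (f ` C)"
  by (intro compact_image dual_tendsto) (auto simp: ck_def)

lemma supp_upper: "C \<in> ck p \<Longrightarrow> f \<in> fdual p \<Longrightarrow> x \<in> C \<Longrightarrow> f x \<le> supp_fun f C"
  unfolding supp_fun_def
  by (intro cSUP_upper bounded_imp_bdd_above compact_imp_bounded compact_dual_image)

lemma supp_least: "C \<in> ck p \<Longrightarrow> (\<And>x. x \<in> C \<Longrightarrow> f x \<le> m) \<Longrightarrow> supp_fun f C \<le> m"
  unfolding supp_fun_def by (intro cSUP_least) (auto simp: ck_def)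

lemma supp_attained:
  assumes "C \<in> ck p" "f \<in> fdual p"
  obtains x where "x \<in> C" "supp_fun f C = f x"
proof -
  have "f ` C \<noteq> {}" using assms(1) by (auto simp: ck_def)
  then obtain x where "x \<in> C" "\<forall>y\<in>C. f y \<le> f x"
    using compact_attains_sup[OF compact_dual_image[OF assms]] by auto
  then show ?thesis using supp_upper[OF assms] supp_least[OF assms(1)] that by (meson antisym)
qed

lemma supp_add:
  assumes "C \<in> ck p" "f \<in> fdual p" "g \<in> fdual p"
  shows "supp_fun (f + g) C \<le> supp_fun f C + supp_fun g C"
  using assms by (intro supp_least) (auto intro!: add_mono supp_upper)

lemma supp_zero: "C \<in> ck p \<Longrightarrow> supp_fun 0 C = 0"
  by (auto simp: supp_fun_def ck_def)

lemma supp_scale: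
  assumes C: "C \<in> ck p" "f \<in> fdual p" and c: "0 \<le> c"
  shows "supp_fun (c *\<^sub>R f) C = c * supp_fun f C"
proof -
  obtain x where x: "x \<in> C" "supp_fun f C = f x" using C by (rule supp_attained)
  have "supp_fun (c *\<^sub>R f) C = (c *\<^sub>R f) x"
  proof (rule antisym)
    show "supp_fun (c *\<^sub>R f) C \<le> (c *\<^sub>R f) x"
      using supp_upper[OF C] x c by (intro supp_least C) (auto intro: mult_left_mono)
    show "(c *\<^sub>R f) x \<le> supp_fun (c *\<^sub>R f) C"
      using C x by (intro supp_upper subspace_scale subspace_fdual)
  qed
  then show ?thesis using x by simp
qed

text \<open>Otherwise choose \<open>s n\<close> in \<open>C\<close> within \<open>1 / Suc n\<close>
  of \<open>y\<close> for the seminorm \<open>p n\<close>. As the seminorms increase, each fixed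
  \<open>p m\<close> is controlled along the tail, so a subsequential limit in \<open>C\<close>
  would be \<open>y\<close>.\<close>

lemma positive_distance:
  assumes C: "C \<in> ck p" and y: "y \<notin> C"
  obtains n e where "0 < e" "\<And>k. k \<in> C \<Longrightarrow> e \<le> p n (y - k)"
proof (rule ccontr)
  assume "\<not> thesis"
  then have "\<exists>k\<in>C. p n (y - k) < 1 / real (Suc n)" for n
    using that[of "1 / real (Suc n)" n] by (force simp: not_less)
  then obtain s where s: "\<And>n. s n \<in> C" "\<And>n. p n (y - s n) < 1 / real (Suc n)" by metis
  have "fcompact p C" using C by (simp add: ck_def)
  then obtain r x where r: "strict_mono r" "x \<in> C" "fconv p (s \<circ> r) x"
    using s(1) by (rule convergent_subsequence)
  have "p m (y - x) = 0" for m
  proof -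
    have "(\<lambda>k. 1 / real (Suc (r k)) + p m ((s \<circ> r) k - x)) \<longlonglongrightarrow> 0 + 0"
      using LIMSEQ_subseq_LIMSEQ[OF LIMSEQ_Suc[OF lim_inverse_n'] r(1)]
      by (intro tendsto_add fconv_seminorm r(3)) (simp add: comp_def)
    moreover have "\<forall>\<^sub>F k in sequentially. p m (y - x) \<le> 1 / real (Suc (r k)) + p m ((s \<circ> r) k - x)"
      using eventually_ge_at_top[of m]
    proof eventually_elim
      case (elim k)
      have "m \<le> r k" using elim seq_suble[OF r(1), of k] by linarith
      then have "p m (y - s (r k)) \<le> 1 / real (Suc (r k))"
        using p_mono[of m "r k" "y - s (r k)"] s(2)[of "r k"] by linarith
      then show ?case using p_triangle[of m y x "s (r k)"] by simp
    qed
    ultimately have "p m (y - x) \<le> 0 + 0" by (intro tendsto_lowerbound) auto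
    then show ?thesis using p_nonneg[of m "y - x"] by linarith
  qed
  then have "y - x = 0" by (rule p_separates)
  with r(2) y show False by simp
qed

text \<open>The cone generated by \<open>{(y - k, e) | k \<in> C}\<close> is dominated by the seminorm, so some dual
  functional exceeds its values on \<open>C\<close> by at least \<open>e\<close> at \<open>y\<close>.\<close>

lemma mem_if_dominated_by_supp:
  assumes C: "C \<in> ck p" and le: "\<And>f. f \<in> fdual p \<Longrightarrow> f y \<le> supp_fun f C"
  shows "y \<in> C"
proof (rule ccontr)
  assume "y \<notin> C"
  with C obtain n e where e: "0 < e" "\<And>k. k \<in> C \<Longrightarrow> e \<le> p n (y - k)"
    by (rule positive_distance) blast
  have conv: "convex C" and "C \<noteq> {}" using C by (auto simp: ck_def)
  let ?P = "{(s *\<^sub>R (y - k), s * e) | s k. 0 \<le> s \<and> k \<in> C}"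
  interpret dominated_cone UNIV "p n" ?P
  proof
    obtain k where "k \<in> C" using \<open>C \<noteq> {}\<close> by auto
    then show "0 \<in> ?P" by (auto simp: zero_prod_def intro!: exI[of _ 0] exI[of _ k])
    show "v + v' \<in> ?P" if v: "v \<in> ?P" "v' \<in> ?P" for v v'
    proof -
      from v obtain s k s' k' where *: "v = (s *\<^sub>R (y - k), s * e)" "v' = (s' *\<^sub>R (y - k'), s' * e)"
        "0 \<le> s" "0 \<le> s'" "k \<in> C" "k' \<in> C" by auto
      show ?thesis
      proof (cases "s + s' = 0")
        case True
        then have "s = 0" "s' = 0" using * by auto
        then show ?thesis using * by (auto intro!: exI[of _ 0] exI[of _ k])
      next
        case False
        \<comment> \<open>The normalised mean of \<open>k\<close> and \<open>k'\<close> merges two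
          generators into one; it lies in \<open>C\<close> by convexity. Its weights are the reason
          for splitting off \<open>s + s' = 0\<close>.\<close>
        define k'' where "k'' = (s / (s + s')) *\<^sub>R k + (s' / (s + s')) *\<^sub>R k'"
        have "s / (s + s') + s' / (s + s') = (s + s') / (s + s')" by (rule add_divide_distrib[symmetric])
        then have "k'' \<in> C" unfolding k''_def
          using *(3-6) False by (intro convexD[OF conv]) simp_all
        moreover have "(s + s') *\<^sub>R k'' = s *\<^sub>R k + s' *\<^sub>R k'"
          using False by (simp add: k''_def scaleR_add_right)
        then have "v + v' = ((s + s') *\<^sub>R (y - k''), (s + s') * e)"
          by (simp add: *(1,2) scaleR_diff_right scaleR_add_left distrib_right)
        ultimately show ?thesis using * by (auto intro!: exI[of _ "s + s'"] exI[of _ k''])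
      qed
    qed
    show "c *\<^sub>R v \<in> ?P" if v: "v \<in> ?P" "0 < c" for v c
    proof -
      from v obtain s k where "v = (s *\<^sub>R (y - k), s * e)" "0 \<le> s" "k \<in> C" by auto
      then show ?thesis using \<open>0 < c\<close> by (auto intro!: exI[of _ "c * s"] exI[of _ k])
    qed
    show "snd v \<le> p n (fst v)" if "v \<in> ?P" for v
      using that e(2) by (auto simp: p_scale intro!: mult_left_mono)
  qed (simp_all add: sublinear_p)
  obtain f where f: "linear_on UNIV f" "\<And>x. f x \<le> p n x" "\<And>v. v \<in> ?P \<Longrightarrow> snd v \<le> f (fst v)"
    by (rule Mazur_Orlicz) auto
  then have lin: "linear f" by (auto simp: linear_on_def intro!: linearI)
  then have dual: "f \<in> fdual p" using f(2) by (rule dualI)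
  obtain k where k: "k \<in> C" "supp_fun f C = f k" using C dual by (rule supp_attained)
  have "(y - k, e) \<in> ?P" using k by (auto intro!: exI[of _ 1])
  from f(3)[OF this] have "e \<le> f y - f k" by (simp add: linear_diff[OF lin])
  with le[OF dual] k e(1) show False by simp
qed

end

lemma sum_fun_apply: "(\<Sum>i\<in>I. f i) x = (\<Sum>i\<in>I. f i x)"
  by (induction I rule: infinite_finite_induct) simp_all

lemma linear_on_combination:
  assumes V: "subspace V" and G: "linear_on V G" and e: "\<And>i. i \<in> I \<Longrightarrow> e i \<in> V"
  shows "G (\<Sum>i\<in>I. c i *\<^sub>R e i) = (\<Sum>i\<in>I. c i * G (e i))"
  using e
proof (induction I rule: infinite_finite_induct)
  case (insert i I)
  have "(\<Sum>i\<in>I. c i *\<^sub>R e i) \<in> V" using insert.prems by (auto intro!: subspace_sum subspace_scale V)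
  then have "G (c i *\<^sub>R e i + (\<Sum>i\<in>I. c i *\<^sub>R e i)) = c i * G (e i) + G (\<Sum>i\<in>I. c i *\<^sub>R e i)"
    using G insert.prems subspace_scale[OF V, of "e i" "c i"] unfolding linear_on_def by simp
  then show ?case using insert by simp
next
  case empty
  have "G (0 *\<^sub>R 0) = 0 * G 0" using G subspace_0[OF V] unfolding linear_on_def by blast
  then show ?case by simp
next
  case (infinite I)
  have "G (0 *\<^sub>R 0) = 0 * G 0" using G subspace_0[OF V] unfolding linear_on_def by blast
  then show ?case using infinite by simp
qed

section \<open>Separability and countable separating families of functionals\<close>

context frechet_seminorms
begin

text \<open>Membership in the closure of \<open>Z\<close>; since the seminorms increase, testing
  them one at a time describes it. \<open>Z\<close> may lie outside the set whose points it
  approximates.\<close>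

definition approximable :: "'a set \<Rightarrow> 'a \<Rightarrow> bool" where
  "approximable Z x \<longleftrightarrow> (\<forall>n. \<forall>e>0. \<exists>z\<in>Z. p n (x - z) < e)"

text \<open>Without a finite net, a greedy choice gives a sequence in \<open>C\<close> that is
  \<open>e\<close>-separated for \<open>p n\<close> and hence has no convergent subsequence.\<close>

lemma finite_net:
  assumes C: "fcompact p C" and e: "0 < e"
  obtains F where "finite F" "F \<subseteq> C" "\<And>x. x \<in> C \<Longrightarrow> \<exists>z\<in>F. p n (x - z) < e"
proof (rule ccontr)
  assume "\<not> thesis"
  with that have *: "\<exists>x\<in>C. \<forall>z\<in>F. \<not> p n (x - z) < e" if "finite F" "F \<subseteq> C" for F
    using \<open>finite F\<close> \<open>F \<subseteq> C\<close> by meson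
  let ?Q = "\<lambda>x k r. r \<in> C \<and> (\<forall>m<(k::nat). \<not> p n (r - x m) < e)"
  have "\<exists>x. \<forall>k::nat. ?Q x k (x k)"
  proof (rule dependent_wellorder_choice)
    fix k x assume "\<And>y. y < k \<Longrightarrow> ?Q x y (x y)"
    then have "x ` {..<k} \<subseteq> C" by auto
    from *[OF _ this] show "\<exists>r. ?Q x k r" by auto
  qed simp
  then obtain s where Q: "\<forall>k::nat. ?Q s k (s k)" by (rule exE)
  then have s: "\<And>k. s k \<in> C" "\<And>m k. m < k \<Longrightarrow> \<not> p n (s k - s m) < e" by simp_all
  obtain r x where r: "strict_mono r" "x \<in> C" "fconv p (s \<circ> r) x"
    using C s(1) by (rule convergent_subsequence)
  obtain N where N: "\<And>k. k \<ge> N \<Longrightarrow> p n (s (r k) - x) < e / 2"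
    using LIMSEQ_D[OF fconv_seminorm[OF r(3), of n], of "e / 2"] e by auto
  have "p n (s (r (Suc N)) - s (r N)) < e"
    using p_triangle[of n "s (r (Suc N))" "s (r N)" x] N[of N] N[of "Suc N"]
    by (simp add: p_minus_commute[of n x])
  moreover have "r N < r (Suc N)" using r(1) by (simp add: strict_mono_Suc_iff)
  ultimately show False using s(2) by blast
qed

lemma countable_dense:
  assumes C: "fcompact p C"
  obtains Z where "countable Z" "\<And>x. x \<in> C \<Longrightarrow> approximable Z x"
proof -
  have "\<exists>F. finite F \<and> (\<forall>x\<in>C. \<exists>z\<in>F. p n (x - z) < 1 / real (Suc k))" for n k
    using finite_net[OF C, of "1 / real (Suc k)" n] by (metis zero_less_divide_1_iff of_nat_0_less_iff zero_less_Suc)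
  then obtain F where F: "\<And>n k. finite (F n k)"
      "\<And>n k x. x \<in> C \<Longrightarrow> \<exists>z\<in>F n k. p n (x - z) < 1 / real (Suc k)"
    by metis
  show ?thesis
  proof
    show "countable (\<Union>n. \<Union>k. F n k)" using F(1) by (intro countable_UN countableI_type countable_finite)
    show "approximable (\<Union>n. \<Union>k. F n k) x" if "x \<in> C" for x
      unfolding approximable_def
    proof (intro allI impI)
      fix n and e :: real assume "0 < e"
      then obtain k where "1 / real (Suc k) < e" using nat_approx_posE by blast
      then show "\<exists>z\<in>\<Union>n. \<Union>k. F n k. p n (x - z) < e"
        using F(2)[OF that, of n k] by force
    qed
  qed
qed

text \<open>Functionals norming the differences of points of \<open>Z\<close> suffice: with
  \<open>a\<close> near \<open>u\<close> and \<open>b\<close> near \<open>v\<close>, the one norming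
  \<open>a - b\<close> almost norms \<open>u - v\<close>.\<close>

lemma countable_separating:
  assumes Z: "countable Z"
  obtains d :: "nat \<Rightarrow> 'a \<Rightarrow> real" where "\<And>i. d i \<in> fdual p"
    "\<And>u v. approximable Z u \<Longrightarrow> approximable Z v \<Longrightarrow> (\<And>i. d i u = d i v) \<Longrightarrow> u = v"
proof -
  have "\<forall>n w. \<exists>f. f \<in> fdual p \<and> f w = p n w \<and> (\<forall>x. \<bar>f x\<bar> \<le> p n x)"
    by (intro allI, rule norming_functional) blast
  then obtain h where "\<forall>n w. h n w \<in> fdual p \<and> h n w w = p n w \<and> (\<forall>x. \<bar>h n w x\<bar> \<le> p n x)"
    unfolding choice_iff by blast
  then have h: "\<And>n w. h n w \<in> fdual p" "\<And>n w. h n w w = p n w" "\<And>n w x. \<bar>h n w x\<bar> \<le> p n x"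
    by auto
  \<comment> \<open>Inserting \<open>0\<close> keeps \<open>D\<close> nonempty for
    \<open>from_nat_into\<close> even if \<open>Z\<close> is empty.\<close>
  define D where "D = insert 0 (\<Union>n. \<Union>a\<in>Z. \<Union>b\<in>Z. {h n (a - b)})"
  have D: "countable D" "D \<noteq> {}" using Z by (auto simp: D_def)
  have "D \<subseteq> fdual p" using h(1) subspace_0[OF subspace_fdual] by (auto simp: D_def)
  show ?thesis
  proof
    show "from_nat_into D i \<in> fdual p" for i
      using from_nat_into[OF D(2)] \<open>D \<subseteq> fdual p\<close> by blast
    fix u v assume u: "approximable Z u" and v: "approximable Z v"
      and eq: "\<And>i. from_nat_into D i u = from_nat_into D i v"
    have eq: "f u = f v" if "f \<in> D" for f
      using eq[of "to_nat_on D f"] from_nat_into_to_nat_on[OF D(1) that] by simp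
    have "p n (u - v) = 0" for n
    proof (rule ccontr)
      assume "p n (u - v) \<noteq> 0"
      \<comment> \<open>A quarter, because four errors add up: \<open>u - a\<close> and
        \<open>v - b\<close> each enter once through the triangle inequality and once through the
        functional.\<close>
      then have pos: "0 < p n (u - v) / 4" using p_nonneg[of n "u - v"] by linarith
      obtain a where a: "a \<in> Z" "p n (u - a) < p n (u - v) / 4"
        using u pos unfolding approximable_def by blast
      obtain b where b: "b \<in> Z" "p n (v - b) < p n (u - v) / 4"
        using v pos unfolding approximable_def by blast
      let ?f = "h n (a - b)"
      have lin: "linear ?f" by (rule dual_linear[OF h(1)])
      have "?f \<in> D" using a b by (auto simp: D_def)
      then have "?f (u - v) = 0" using eq by (simp add: linear_diff[OF lin])
      moreover have "?f (a - b) = ?f (u - v) - ?f (u - a) + ?f (v - b)"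
        by (simp add: linear_diff[OF lin])
      moreover have "p n (u - v) \<le> p n (u - a) + (p n (a - b) + p n (b - v))"
        using p_triangle[of n u v a] p_triangle[of n a v b] by linarith
      ultimately show False
        using h(2)[of n "a - b"] h(3)[of n "a - b" "u - a"] h(3)[of n "a - b" "v - b"] a(2) b(2)
          p_minus_commute[of n b v] by linarith
    qed
    then have "u - v = 0" by (rule p_separates)
    then show "u = v" by simp
  qed
qed

section \<open>Points at which functionals take prescribed values\<close>

lemma dual_combination:
  "(\<And>i. i \<in> I \<Longrightarrow> d i \<in> fdual p) \<Longrightarrow> (\<Sum>i\<in>I. c i *\<^sub>R d i) \<in> fdual p"
  by (intro subspace_sum subspace_scale subspace_fdual)

text \<open>Take the point \<open>z\<close> of \<open>C\<close> minimising \<open>\<Sum>i<m. (d i x - g i)\<^sup>2\<close>. If the minimum is positive, the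
  combination of the \<open>d i\<close> with coefficients \<open>g i - d i z\<close> violates the bound; multiplying by a
  large \<open>N\<close> and rounding makes the coefficients integers.\<close>

lemma finite_interpolation:
  assumes C: "C \<in> ck p" and d: "\<And>i. d i \<in> fdual p"
    and le: "\<And>c :: nat \<Rightarrow> int. (\<Sum>i<m. real_of_int (c i) * g i) \<le> supp_fun (\<Sum>i<m. real_of_int (c i) *\<^sub>R d i) C"
  obtains z where "z \<in> C" "\<And>i. i < m \<Longrightarrow> d i z = g i"
proof -
  define F where "F x = (\<Sum>i<m. (d i x - g i)\<^sup>2)" for x
  have "C \<noteq> {}" "fcompact p C" and conv: "convex C" using C by (auto simp: ck_def)
  have "compact (F ` C)" unfolding F_def
    by (intro compact_image \<open>fcompact p C\<close> tendsto_intros dual_tendsto d)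
  then obtain z where z: "z \<in> C" "\<And>x. x \<in> C \<Longrightarrow> F z \<le> F x"
    using compact_attains_inf[of "F ` C"] \<open>C \<noteq> {}\<close> by auto
  define c where "c i = g i - d i z" for i
  define \<rho> where "\<rho> = (\<Sum>i<m. (c i)\<^sup>2)"
  have "\<rho> = F z" by (simp add: \<rho>_def F_def c_def power2_commute)
  have lin: "linear (d i)" for i by (rule dual_linear[OF d])
  \<comment> \<open>First-order condition at the minimiser: moving from \<open>z\<close> towards
    \<open>x\<close> inside \<open>C\<close> cannot decrease \<open>F\<close>.\<close>
  have var: "(\<Sum>i<m. c i * (d i x - d i z)) \<le> 0" if x: "x \<in> C" for x
  proof (rule ccontr)
    define a where "a = (\<Sum>i<m. c i * (d i x - d i z))"
    define b where "b = (\<Sum>i<m. (d i x - d i z)\<^sup>2)"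
    assume "\<not> (\<Sum>i<m. c i * (d i x - d i z)) \<le> 0"
    then have a: "0 < a" by (simp add: a_def)
    have b: "0 \<le> b" by (auto simp: b_def intro: sum_nonneg)
    \<comment> \<open>This step length stays on the segment and gives \<open>s * b \<le> a\<close>,
      whereas minimality would force \<open>2 * a \<le> s * b\<close>. The summand \<open>1\<close>
      keeps the denominator positive.\<close>
    define s where "s = min 1 (a / (1 + b))"
    have s: "0 < s" "s \<le> 1" "s \<le> a / (1 + b)" using a b by (auto simp: s_def)
    have "(1 - s) *\<^sub>R z + s *\<^sub>R x \<in> C"
      using x z(1) s by (intro convexD[OF conv]) auto
    then have min: "\<rho> \<le> F ((1 - s) *\<^sub>R z + s *\<^sub>R x)" using z(2) \<open>\<rho> = F z\<close> by simp
    have di: "d i ((1 - s) *\<^sub>R z + s *\<^sub>R x) = (1 - s) * d i z + s * d i x" for i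
      by (simp add: linear_add[OF lin] linear_scale[OF lin])
    have "F ((1 - s) *\<^sub>R z + s *\<^sub>R x) = (\<Sum>i<m. (c i)\<^sup>2 - 2 * s * (c i * (d i x - d i z)) + s\<^sup>2 * (d i x - d i z)\<^sup>2)"
      unfolding F_def di by (intro sum.cong refl)
        (simp add: c_def power2_eq_square algebra_simps)
    also have "\<dots> = \<rho> - 2 * s * a + s\<^sup>2 * b"
      by (simp add: \<rho>_def a_def b_def sum.distrib sum_subtractf sum_distrib_left)
    finally have "s * (2 * a) \<le> s * (s * b)" using min by (simp add: power2_eq_square)
    then have "2 * a \<le> s * b" using s(1) by simp
    also have "\<dots> \<le> a / (1 + b) * b" using s(3) b by (rule mult_right_mono)
    also have "\<dots> \<le> a" using a b by (simp add: field_simps)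
    finally show False using a by simp
  qed
  have "\<rho> = 0"
  proof (rule ccontr)
    assume "\<rho> \<noteq> 0"
    then have "0 < \<rho>" using sum_nonneg[of "{..<m}" "\<lambda>i. (c i)\<^sup>2"] by (simp add: \<rho>_def less_le)
    have "bdd_above ((\<lambda>x. \<Sum>i<m. \<bar>g i - d i x\<bar>) ` C)"
      by (intro bounded_imp_bdd_above compact_imp_bounded compact_image \<open>fcompact p C\<close>
          tendsto_intros dual_tendsto d)
    then obtain M where "\<forall>r\<in>(\<lambda>x. \<Sum>i<m. \<bar>g i - d i x\<bar>) ` C. r \<le> M"
      unfolding bdd_above_def by (rule exE)
    then have M: "(\<Sum>i<m. \<bar>g i - d i x\<bar>) \<le> M" if "x \<in> C" for x
      using that by simp
    \<comment> \<open>Rounding moves each coefficient by at most 1, which costs at most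
      \<open>M\<close> in total, uniformly on \<open>C\<close>; \<open>N\<close> makes the gain
      \<open>N * \<rho>\<close> larger.\<close>
    obtain N where N: "M < real N * \<rho>" using reals_Archimedean3[OF \<open>0 < \<rho>\<close>] by blast
    define k where "k i = \<lfloor>real N * c i\<rfloor>" for i
    obtain x where x: "x \<in> C" "supp_fun (\<Sum>i<m. real_of_int (k i) *\<^sub>R d i) C
        = (\<Sum>i<m. real_of_int (k i) *\<^sub>R d i) x"
      using C dual_combination[of "{..<m}", OF d] by (rule supp_attained)
    have "(\<Sum>i<m. real_of_int (k i) * g i) \<le> (\<Sum>i<m. k i * d i x)"
      using le[of k] x by (simp add: sum_fun_apply)
    then have "(\<Sum>i<m. k i * (g i - d i x)) \<le> 0" by (simp add: right_diff_distrib sum_subtractf)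
    moreover have "(\<Sum>i<m. real N * (c i * (g i - d i x)) - \<bar>g i - d i x\<bar>) \<le> (\<Sum>i<m. k i * (g i - d i x))"
    proof (rule sum_mono)
      fix i
      have "\<bar>(real N * c i - k i) * (g i - d i x)\<bar> \<le> 1 * \<bar>g i - d i x\<bar>"
        unfolding abs_mult by (intro mult_right_mono) (simp_all add: k_def, linarith)
      then show "real N * (c i * (g i - d i x)) - \<bar>g i - d i x\<bar> \<le> k i * (g i - d i x)"
        by (simp add: abs_le_iff algebra_simps)
    qed
    moreover have "(\<Sum>i<m. c i * (g i - d i x)) = \<rho> - (\<Sum>i<m. c i * (d i x - d i z))"
      unfolding \<rho>_def sum_subtractf[symmetric]
      by (intro sum.cong refl) (simp add: c_def power2_eq_square algebra_simps)
    then have "real N * \<rho> \<le> (\<Sum>i<m. real N * (c i * (g i - d i x)))"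
      using var[OF x(1)] by (simp flip: sum_distrib_left add: mult_left_mono)
    ultimately show False using M[OF x(1)] N by (simp add: sum_subtractf)
  qed
  then have "\<forall>i<m. c i = 0" by (simp add: \<rho>_def sum_nonneg_eq_0_iff)
  then show ?thesis using that[OF z(1)] by (simp add: c_def)
qed

text \<open>With integer instead of real coefficients these are countably many conditions, so that they can
  hold simultaneously almost everywhere.\<close>

definition interpolates :: "(nat \<Rightarrow> 'a \<Rightarrow> real) \<Rightarrow> (nat \<Rightarrow> real) \<Rightarrow> 'a set \<Rightarrow> bool" where
  "interpolates d g C \<longleftrightarrow> (\<forall>c :: int list. (\<Sum>i<length c. real_of_int (c ! i) * g i)
     \<le> supp_fun (\<Sum>i<length c. real_of_int (c ! i) *\<^sub>R d i) C)"

text \<open>Solve the first \<open>m\<close> equations for every \<open>m\<close> and take a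
  subsequential limit; each single equation holds from some index on.\<close>

lemma interpolation:
  assumes C: "C \<in> ck p" and d: "\<And>i. d i \<in> fdual p" and le: "interpolates d g C"
  obtains z where "z \<in> C" "\<And>i. d i z = g i"
proof -
  have "\<exists>z\<in>C. \<forall>i<m. d i z = g i" for m
  proof (rule finite_interpolation[OF C d])
    fix c :: "nat \<Rightarrow> int"
    show "(\<Sum>i<m. real_of_int (c i) * g i) \<le> supp_fun (\<Sum>i<m. real_of_int (c i) *\<^sub>R d i) C"
      using le[unfolded interpolates_def, rule_format, of "map c [0..<m]"] by simp
  qed blast
  then obtain s where s: "\<And>m. s m \<in> C" "\<And>m i. i < m \<Longrightarrow> d i (s m) = g i" by metis
  have "fcompact p C" using C by (simp add: ck_def)
  then obtain r x where r: "strict_mono r" "x \<in> C" "fconv p (s \<circ> r) x"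
    using s(1) by (rule convergent_subsequence)
  have "d i x = g i" for i
  proof (rule LIMSEQ_unique)
    show "(\<lambda>k. d i ((s \<circ> r) k)) \<longlonglongrightarrow> d i x" by (rule dual_tendsto[OF d r(3)])
    have "\<forall>\<^sub>F k in sequentially. d i ((s \<circ> r) k) = g i"
      using eventually_gt_at_top[of i]
    proof eventually_elim
      case (elim k)
      then show ?case using s(2)[of i "r k"] seq_suble[OF r(1), of k] by simp
    qed
    then show "(\<lambda>k. d i ((s \<circ> r) k)) \<longlonglongrightarrow> g i" by (rule tendsto_eventually)
  qed
  with r(2) that show ?thesis by blast
qed

text \<open>A separating sequence \<open>d\<close> fixes \<open>z\<close>. For any further
  \<open>f\<close>, interpolating \<open>f\<close> together with \<open>d\<close> gives a point of
  \<open>C\<close> that agrees with \<open>z\<close> on \<open>d\<close> and is therefore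
  \<open>z\<close>.\<close>

lemma represent_linear_functional:
  assumes C: "C \<in> ck p" and G: "linear_on (fdual p) G" and le: "\<And>f. f \<in> fdual p \<Longrightarrow> G f \<le> supp_fun f C"
  obtains z where "z \<in> C" "\<And>f. f \<in> fdual p \<Longrightarrow> G f = f z"
proof -
  have "fcompact p C" using C by (simp add: ck_def)
  then obtain Z where Z: "countable Z" "\<And>x. x \<in> C \<Longrightarrow> approximable Z x"
    by (rule countable_dense) blast
  obtain d :: "nat \<Rightarrow> 'a \<Rightarrow> real" where d: "\<And>i. d i \<in> fdual p"
      and sep: "\<And>u v. approximable Z u \<Longrightarrow> approximable Z v \<Longrightarrow> (\<And>i. d i u = d i v) \<Longrightarrow> u = v"
    by (rule countable_separating[OF Z(1)]) blast
  have "interpolates e (\<lambda>i. G (e i)) C" if e: "\<And>i. e i \<in> fdual p" for e :: "nat \<Rightarrow> 'a \<Rightarrow> real"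
    unfolding interpolates_def
  proof
    fix c :: "int list"
    have "G (\<Sum>i<length c. real_of_int (c ! i) *\<^sub>R e i) = (\<Sum>i<length c. real_of_int (c ! i) * G (e i))"
      using e by (intro linear_on_combination[OF subspace_fdual G]) auto
    moreover have "(\<Sum>i<length c. real_of_int (c ! i) *\<^sub>R e i) \<in> fdual p"
      using e by (rule dual_combination)
    ultimately show "(\<Sum>i<length c. real_of_int (c ! i) * G (e i))
        \<le> supp_fun (\<Sum>i<length c. real_of_int (c ! i) *\<^sub>R e i) C"
      using le by metis
  qed
  note dominated = this
  have ex: "\<exists>z\<in>C. \<forall>i. e i z = G (e i)" if "\<And>i. e i \<in> fdual p" for e :: "nat \<Rightarrow> 'a \<Rightarrow> real"
    using C that dominated[of e, OF that] by (rule interpolation) blast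
  obtain z where z: "z \<in> C" "\<And>i. d i z = G (d i)" using ex[of d] d by blast
  have "G f = f z" if f: "f \<in> fdual p" for f
  proof -
    \<comment> \<open>\<open>case_nat f d\<close> puts \<open>f\<close> at index 0 and shifts
      \<open>d\<close> by one.\<close>
    have "case_nat f d i \<in> fdual p" for i using d f by (cases i) auto
    then obtain z' where z': "z' \<in> C" "\<forall>i. case_nat f d i z' = G (case_nat f d i)"
      using ex[of "case_nat f d"] by blast
    have "d i z' = d i z" for i using spec[OF z'(2), of "Suc i"] z(2) by simp
    then have "z' = z" using sep Z(2) z(1) z'(1) by blast
    then show ?thesis using spec[OF z'(2), of 0] by simp
  qed
  with z(1) that show ?thesis by blast
qed

text \<open>\<open>fdist\<close> lies between 0 and 1, so the infima and suprema in
  \<open>fhaus\<close> are over bounded sets and the strict bound passes to each point.\<close>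

lemma fhaus_nearest:
  assumes "A \<noteq> {}" "B \<noteq> {}" "fhaus p A B < e"
  shows "a \<in> A \<Longrightarrow> \<exists>b\<in>B. fdist p a b < e" and "b \<in> B \<Longrightarrow> \<exists>a\<in>A. fdist p a b < e"
proof -
  have bb: "bdd_below (fdist p a ` B)" "bdd_below ((\<lambda>a. fdist p a b) ` A)" for a b
    by (auto intro!: bdd_belowI2[where m = 0])
  have "(INF b\<in>B. fdist p a b) \<le> 1" for a
    using assms(2) cINF_lower[OF bb(1)] fdist_le_1 by (metis ex_in_conv order_trans)
  then have ba: "bdd_above ((\<lambda>a. INF b\<in>B. fdist p a b) ` A)" by (intro bdd_aboveI2)
  have "(INF a\<in>A. fdist p a b) \<le> 1" for b
    using assms(1) cINF_lower[OF bb(2)] fdist_le_1 by (metis ex_in_conv order_trans)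
  then have bc: "bdd_above ((\<lambda>b. INF a\<in>A. fdist p a b) ` B)" by (intro bdd_aboveI2)
  show "\<exists>b\<in>B. fdist p a b < e" if "a \<in> A"
  proof -
    have "(INF b\<in>B. fdist p a b) < e"
      using cSUP_upper[OF that ba] assms(3) by (simp add: fhaus_def)
    then show ?thesis unfolding cINF_less_iff[OF assms(2) bb(1)] .
  qed
  show "\<exists>a\<in>A. fdist p a b < e" if "b \<in> B"
  proof -
    have "(INF a\<in>A. fdist p a b) < e"
      using cSUP_upper[OF that bc] assms(3) by (simp add: fhaus_def)
    then show ?thesis unfolding cINF_less_iff[OF assms(1) bb(2)] .
  qed
qed

end

section \<open>Measure-theoretic tools\<close>

lemma integrable_imp_set_integrable:
  fixes f :: "_ \<Rightarrow> real"
  shows "integrable M f \<Longrightarrow> A \<in> sets M \<Longrightarrow> set_integrable M A f"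
  unfolding set_integrable_def by (rule integrable_mult_indicator)

text \<open>Domination by the integral of \<open>w\<close> makes \<open>\<mu>\<close> continuous at
  the empty set, which upgrades finite to countable additivity, and absolutely continuous.
  Radon-Nikodym then applies.\<close>

lemma dominated_additive_density:
  fixes \<mu> :: "'b set \<Rightarrow> real"
  assumes M: "finite_measure M" and w: "integrable M w"
    and nonneg: "\<And>A. A \<in> sets M \<Longrightarrow> 0 \<le> \<mu> A"
    and le: "\<And>A. A \<in> sets M \<Longrightarrow> \<mu> A \<le> (LINT t:A|M. w t)"
    and add: "\<And>A B. A \<in> sets M \<Longrightarrow> B \<in> sets M \<Longrightarrow> A \<inter> B = {} \<Longrightarrow> \<mu> (A \<union> B) = \<mu> A + \<mu> B"
  obtains h where "integrable M h" "\<And>A. A \<in> sets M \<Longrightarrow> \<mu> A = (LINT t:A|M. h t)"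
proof -
  interpret finite_measure M by fact
  define N where "N = measure_of (space M) (sets M) (\<lambda>A. ennreal (\<mu> A))"
  have [simp]: "\<mu> {} = 0" using add[of "{}" "{}"] by simp
  have "countably_additive (sets M) (\<lambda>A. ennreal (\<mu> A))"
  proof (rule sets.empty_continuous_imp_countably_additive)
    show "positive (sets M) (\<lambda>A. ennreal (\<mu> A))" by (simp add: positive_def)
    show "additive (sets M) (\<lambda>A. ennreal (\<mu> A))" by (auto simp: additive_def add nonneg)
    fix A :: "nat \<Rightarrow> _" assume A: "range A \<subseteq> sets M" "decseq A" "(\<Inter>i. A i) = {}"
    have "(\<lambda>i. LINT t:A i|M. w t) \<longlonglongrightarrow> (LINT t:(\<Inter>i. A i)|M. w t)"
      using A w by (intro set_integral_cont_down) (auto intro: integrable_imp_set_integrable)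
    then have lim: "(\<lambda>i. LINT t:A i|M. w t) \<longlonglongrightarrow> 0"
      unfolding A(3) by (simp add: set_lebesgue_integral_def)
    have "(\<lambda>i. \<mu> (A i)) \<longlonglongrightarrow> 0"
      by (rule tendsto_sandwich[OF _ _ tendsto_const lim]) (use A(1) nonneg le in auto)
    then show "(\<lambda>i. ennreal (\<mu> (A i))) \<longlonglongrightarrow> 0" using tendsto_ennrealI by fastforce
  qed simp
  then have N: "emeasure N A = ennreal (\<mu> A)" if "A \<in> sets M" for A
    unfolding N_def using that
    by (intro emeasure_measure_of_sigma sets.sigma_algebra_axioms) (auto simp: positive_def)
  have sets_N: "sets N = sets M" by (simp add: N_def)
  have "absolutely_continuous M N"
    unfolding absolutely_continuous_def
  proof
    fix A assume A: "A \<in> null_sets M"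
    then have "AE t in M. t \<notin> A" by (rule AE_not_in)
    then have "(LINT t:A|M. w t) = 0" unfolding set_lebesgue_integral_def
      by (intro integral_eq_zero_AE) (auto elim!: eventually_mono)
    then have "\<mu> A = 0" using le[of A] nonneg[of A] A by (simp add: null_setsD2)
    then show "A \<in> null_sets N" using A by (auto simp: null_sets_def sets_N N)
  qed
  then obtain f where f[measurable]: "f \<in> borel_measurable M" and fN: "density M f = N"
    using Radon_Nikodym sets_N by blast
  have f_int: "(\<integral>\<^sup>+t. f t * indicator A t \<partial>M) = ennreal (\<mu> A)" if "A \<in> sets M" for A
    using emeasure_density[OF f that] N[OF that] by (simp add: fN)
  have fin: "(\<integral>\<^sup>+t. f t \<partial>M) = ennreal (\<mu> (space M))"
    using f_int[of "space M"] by (simp add: nn_integral_indicator_finite[symmetric] cong: nn_integral_cong)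
  \<comment> \<open>The total mass is finite, so the extended density is finite almost everywhere
    and can be made real.\<close>
  then have "AE t in M. f t \<noteq> \<infinity>" by (intro nn_integral_PInf_AE f) simp
  then have ae: "AE t in M. f t = ennreal (enn2real (f t))"
    by eventually_elim (simp add: less_top)
  define h where "h t = enn2real (f t)" for t
  have [measurable]: "h \<in> borel_measurable M" unfolding h_def by measurable
  have h_int: "(\<integral>\<^sup>+t. ennreal (indicator A t *\<^sub>R h t) \<partial>M) = ennreal (\<mu> A)" if "A \<in> sets M" for A
  proof -
    have "(\<integral>\<^sup>+t. ennreal (indicator A t *\<^sub>R h t) \<partial>M) = (\<integral>\<^sup>+t. f t * indicator A t \<partial>M)"
      using ae by (intro nn_integral_cong_AE) (auto elim!: eventually_mono simp: h_def split: split_indicator)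
    then show ?thesis using f_int[OF that] by simp
  qed
  show ?thesis
  proof
    have "(\<integral>\<^sup>+t. ennreal (h t) \<partial>M) = (\<integral>\<^sup>+t. f t \<partial>M)"
      using ae by (intro nn_integral_cong_AE) (auto elim!: eventually_mono simp: h_def)
    then show "integrable M h" using fin by (intro integrableI_nonneg) (auto simp: h_def)
    fix A assume A: "A \<in> sets M"
    have "(LINT t:A|M. h t) = enn2real (\<integral>\<^sup>+t. ennreal (indicator A t *\<^sub>R h t) \<partial>M)"
      unfolding set_lebesgue_integral_def using A
      by (intro integral_eq_nn_integral) (auto simp: h_def)
    then show "\<mu> A = (LINT t:A|M. h t)" using h_int[OF A] nonneg[OF A] by simp
  qed
qed

text \<open>Test on the set where \<open>v < u\<close>: the integral of the nonnegative
  \<open>u - v\<close> over it is at most 0.\<close>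

lemma AE_le_if_set_integral_le:
  fixes u v :: "'b \<Rightarrow> real"
  assumes u: "integrable M u" and v: "integrable M v"
    and le: "\<And>A. A \<in> sets M \<Longrightarrow> (LINT t:A|M. u t) \<le> (LINT t:A|M. v t)"
  shows "AE t in M. u t \<le> v t"
proof -
  have [measurable]: "u \<in> borel_measurable M" "v \<in> borel_measurable M" using u v by auto
  define A where "A = {t \<in> space M. v t < u t}"
  have A: "A \<in> sets M" unfolding A_def by measurable
  have int: "integrable M (\<lambda>t. indicator A t *\<^sub>R (u t - v t))"
    using A u v by (intro integrable_mult_indicator Bochner_Integration.integrable_diff)
  have nonneg: "AE t in M. 0 \<le> indicator A t *\<^sub>R (u t - v t)"
    by (auto simp: A_def split: split_indicator)
  have "(LINT t|M. indicator A t *\<^sub>R (u t - v t)) = (LINT t:A|M. u t) - (LINT t:A|M. v t)"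
    using set_integral_diff(2)[OF integrable_imp_set_integrable[OF u A] integrable_imp_set_integrable[OF v A]]
    by (simp add: set_lebesgue_integral_def)
  then have "(LINT t|M. indicator A t *\<^sub>R (u t - v t)) = 0"
    using le[OF A] integral_nonneg_AE[OF nonneg] by linarith
  then have "AE t in M. indicator A t *\<^sub>R (u t - v t) = 0"
    using integral_nonneg_eq_0_iff_AE[OF int nonneg] by simp
  then show ?thesis
    using AE_space by eventually_elim (auto simp: A_def split: split_indicator_asm)
qed

lemma complete_measure_lebesgue_on:
  assumes "S \<in> sets lebesgue" shows "complete_measure (lebesgue_on S)"
proof
  fix A B assume "B \<subseteq> A" "A \<in> null_sets (lebesgue_on S)"
  then have "A \<in> null_sets lebesgue" "B \<subseteq> S" using assms by (auto simp: null_sets_restrict_space)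
  then have "B \<in> sets lebesgue" using completion.complete2[of B A] \<open>B \<subseteq> A\<close> by auto
  then show "B \<in> sets (lebesgue_on S)"
    using \<open>B \<subseteq> S\<close> assms by (auto simp: sets_restrict_space image_iff intro!: bexI[of _ B])
qed

text \<open>For a selection chosen point by point: its scalarisations are known only to agree almost
  everywhere with measurable densities, and completeness makes them measurable.\<close>

lemma (in complete_measure) borel_measurable_if_AE_eq:
  fixes f g :: "'a \<Rightarrow> real"
  assumes g: "g \<in> borel_measurable M" and ae: "AE t in M. f t = g t"
  shows "f \<in> borel_measurable M"
proof (rule measurableI)
  fix B :: "real set" assume "B \<in> sets borel"
  then have "g -` B \<inter> space M \<in> sets M" using g by (auto intro: measurable_sets)
  moreover have "AE t in M. t \<in> g -` B \<inter> space M \<longleftrightarrow> t \<in> f -` B \<inter> space M"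
    using ae by eventually_elim auto
  ultimately show "f -` B \<inter> space M \<in> sets M" using in_sets_AE by blast
qed simp

text \<open>Moves the integrals in the definitions of the Pettis integrals to one fixed measure
  space.\<close>

lemma integral_lebesgue_on_eq_set_integral:
  fixes f :: "real \<Rightarrow> real"
  assumes A: "A \<in> sets I01"
  shows "integral\<^sup>L (lebesgue_on A) f = (LINT t:A|I01. f t)"
proof -
  have "{0..1::real} \<in> sets lebesgue" by simp
  then have *: "A \<in> sets lebesgue" "A \<subseteq> {0..1}" using A by (auto simp: sets_restrict_space)
  then have "lebesgue_on A = restrict_space I01 A"
    by (subst restrict_restrict_space) (auto simp: Int_absorb1)
  then show ?thesis
    using A * by (simp add: integral_restrict_space Int_absorb2 set_lebesgue_integral_def)
qed

section \<open>Integrals of selections\<close>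

lemma simple_mf_values:
  assumes "simple_mf p S"
  shows finite_range_simple_mf: "finite (S ` {0..1})"
    and simple_mf_nonempty: "t \<in> {0..1} \<Longrightarrow> S t \<noteq> {}"
proof -
  obtain m :: nat and A C where *: "(\<forall>j<m. A j \<in> sets I01 \<and> C j \<in> cb p)
      \<and> (\<forall>i<m. \<forall>j<m. i \<noteq> j \<longrightarrow> A i \<inter> A j = {})
      \<and> (\<forall>t\<in>{0..1}. (\<forall>j<m. t \<in> A j \<longrightarrow> S t = C j) \<and> ((\<forall>j<m. t \<notin> A j) \<longrightarrow> S t = {0}))"
    using assms unfolding simple_mf_def by (elim exE) (rule that)
  have val: "S t \<in> insert {0} (C ` {..<m})" if "t \<in> {0..1}" for t
    using bspec[OF conjunct2[OF conjunct2[OF *]] that] by (cases "\<exists>j<m. t \<in> A j") auto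
  then have "S ` {0..1} \<subseteq> insert {0} (C ` {..<m})" by blast
  then show "finite (S ` {0..1})" by (rule finite_subset) simp
  show "S t \<noteq> {}" if "t \<in> {0..1}"
    using val[OF that] conjunct1[OF *] by (auto simp: cb_def)
qed

text \<open>Each value of an approximating simple multifunction that comes close to some \<open>\<Gamma> t\<close> is replaced
  by such a \<open>\<Gamma> t\<close>; unlike closed bounded sets, these are compact and hence separable.\<close>

lemma (in frechet_seminorms) Bochner_measurable_separable:
  assumes ck: "\<And>t. t \<in> {0..1} \<Longrightarrow> \<Gamma> t \<in> ck p" and B: "bochner_meas_mf p \<Gamma>"
  obtains Z where "countable Z" "AE t in I01. \<forall>x\<in>\<Gamma> t. approximable Z x"
proof -
  obtain S where S: "\<And>n. simple_mf p (S n)" and conv: "AE t in I01. (\<lambda>n. fhaus p (S n t) (\<Gamma> t)) \<longlonglongrightarrow> 0"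
    using B unfolding bochner_meas_mf_def by blast
  define \<C> where "\<C> = (\<Union>n. S n ` {0..1})"
  have "countable \<C>" unfolding \<C>_def
    by (intro countable_UN countableI_type countable_finite finite_range_simple_mf[OF S])
  have ne: "C \<noteq> {}" if "C \<in> \<C>" for C
    using that simple_mf_nonempty[OF S] by (auto simp: \<C>_def)
  have "\<forall>t\<in>{0..1}. \<exists>Z. countable Z \<and> (\<forall>x\<in>\<Gamma> t. approximable Z x)"
  proof
    fix t :: real assume "t \<in> {0..1}"
    then have "fcompact p (\<Gamma> t)" using ck by (simp add: ck_def)
    then show "\<exists>Z. countable Z \<and> (\<forall>x\<in>\<Gamma> t. approximable Z x)"
      by (rule countable_dense) blast
  qed
  from bchoice[OF this] obtain D
    where D: "\<forall>t\<in>{0..1}. countable (D t) \<and> (\<forall>x\<in>\<Gamma> t. approximable (D t) x)"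
    by (rule exE)
  define close where "close C k t \<longleftrightarrow> t \<in> {0..1} \<and> fhaus p C (\<Gamma> t) < 1 / real (Suc k)" for C k t
  \<comment> \<open>The default 0 keeps \<open>\<tau> C k\<close> in the unit interval, where
    \<open>D\<close> is known to be countable.\<close>
  define \<tau> where "\<tau> C k = (if \<exists>t. close C k t then SOME t. close C k t else 0)" for C k
  have \<tau>: "close C k (\<tau> C k)" if "close C k t" for C k t
  proof -
    have "close C k (SOME t. close C k t)" using that by (rule someI)
    then show ?thesis using that by (auto simp: \<tau>_def)
  qed
  have \<tau>_mem: "\<tau> C k \<in> {0..1}" for C k
    using \<tau>[of C k] by (cases "\<exists>t. close C k t") (auto simp: close_def \<tau>_def)
  define Z where "Z = (\<Union>C\<in>\<C>. \<Union>k. D (\<tau> C k))"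
  show ?thesis
  proof
    show "countable Z" unfolding Z_def
      using \<open>countable \<C>\<close> D \<tau>_mem by (intro countable_UN countableI_type) auto
    show "AE t in I01. \<forall>x\<in>\<Gamma> t. approximable Z x"
      using conv AE_space
    proof eventually_elim
      case (elim t)
      then have t: "t \<in> {0..1}" by simp
      have "\<Gamma> t \<noteq> {}" using ck[OF t] by (simp add: ck_def)
      show ?case unfolding approximable_def
      proof (intro ballI allI impI)
        fix x n and e :: real assume x: "x \<in> \<Gamma> t" and "0 < e"
        \<comment> \<open>Thirds, for the chain from \<open>x\<close> through \<open>c\<close> and
          \<open>y\<close> to \<open>z\<close>, with \<open>c\<close> in a value of the approximant
          and \<open>y\<close> in the representative \<open>\<Gamma> (\<tau> C k)\<close> of that
          value.\<close>
        then have e: "0 < e / 3" by simp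
        then obtain d where d: "0 < d" "\<And>x y. fdist p x y < d \<Longrightarrow> p n (x - y) < e / 3"
          by (rule seminorm_small_if_fdist_small[where n = n]) blast
        obtain k where k: "1 / real (Suc k) < d" using d(1) nat_approx_posE by blast
        have "\<forall>\<^sub>F m in sequentially. fhaus p (S m t) (\<Gamma> t) < 1 / real (Suc k)"
          using elim(1) by (rule order_tendstoD) simp
        then obtain m where m: "fhaus p (S m t) (\<Gamma> t) < 1 / real (Suc k)"
          using eventually_happens'[OF sequentially_bot] by blast
        define C where "C = S m t"
        have C: "C \<in> \<C>" using t unfolding C_def \<C>_def by blast
        have "close C k t" using t m by (simp add: close_def C_def)
        then have s: "\<tau> C k \<in> {0..1}" "fhaus p C (\<Gamma> (\<tau> C k)) < 1 / real (Suc k)"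
          using \<tau> by (auto simp: close_def)
        obtain c where c: "c \<in> C" "fdist p c x < 1 / real (Suc k)"
          using fhaus_nearest(2)[OF ne[OF C] \<open>\<Gamma> t \<noteq> {}\<close> m[folded C_def] x] by blast
        have "\<Gamma> (\<tau> C k) \<noteq> {}" using ck[OF s(1)] by (simp add: ck_def)
        then obtain y where y: "y \<in> \<Gamma> (\<tau> C k)" "fdist p c y < 1 / real (Suc k)"
          using fhaus_nearest(1)[OF ne[OF C] _ s(2) c(1)] by blast
        have "approximable (D (\<tau> C k)) y" using D s(1) y(1) by blast
        then obtain z where z: "z \<in> D (\<tau> C k)" "p n (y - z) < e / 3"
          using e unfolding approximable_def by blast
        have "p n (c - x) < e / 3" "p n (c - y) < e / 3" using c(2) y(2) k d(2) by auto
        then have "p n (x - z) < e"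
          using z(2) p_triangle[of n x z c] p_triangle[of n c z y] p_minus_commute[of n x c] by linarith
        moreover have "z \<in> Z" using z(1) C by (auto simp: Z_def)
        ultimately show "\<exists>z\<in>Z. p n (x - z) < e" by blast
      qed
    qed
  qed
qed

locale pettis_multifunction = frechet_seminorms p
  for p :: "nat \<Rightarrow> 'a::real_vector \<Rightarrow> real" +
  fixes \<Gamma> :: "real \<Rightarrow> 'a set"
  assumes ck: "\<And>t. t \<in> {0..1} \<Longrightarrow> \<Gamma> t \<in> ck p"
    and pettis: "pettis_integrable_mf p \<Gamma>"
begin

lemma supp_integrable: "f \<in> fdual p \<Longrightarrow> integrable I01 (\<lambda>t. supp_fun f (\<Gamma> t))"
  using pettis by (auto simp: pettis_integrable_mf_def)

lemma supp_set_integrable: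
  "f \<in> fdual p \<Longrightarrow> A \<in> sets I01 \<Longrightarrow> set_integrable I01 A (\<lambda>t. supp_fun f (\<Gamma> t))"
  by (intro integrable_imp_set_integrable supp_integrable)

lemma supp_integral:
  assumes "A \<in> sets I01" "is_pettis_int_mf p \<Gamma> A K" "f \<in> fdual p"
  shows "supp_fun f K = (LINT t:A|I01. supp_fun f (\<Gamma> t))"
  using assms by (simp add: is_pettis_int_mf_def integral_lebesgue_on_eq_set_integral)

section \<open>Dual-valued simple functions and the integrated support functional\<close>

definition simple_dual :: "(real \<Rightarrow> 'a \<Rightarrow> real) set" where
  "simple_dual = {\<phi>. simple_function I01 \<phi> \<and> (\<forall>t. \<phi> t \<in> fdual p)}"

definition supp_int :: "(real \<Rightarrow> 'a \<Rightarrow> real) \<Rightarrow> real" where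
  "supp_int \<phi> = (LINT t|I01. supp_fun (\<phi> t) (\<Gamma> t))"

text \<open>The elementary function \<open>\<chi>\<^sub>A f\<close>.\<close>

definition cut :: "real set \<Rightarrow> ('a \<Rightarrow> real) \<Rightarrow> real \<Rightarrow> 'a \<Rightarrow> real" where
  "cut A f = (\<lambda>t. if t \<in> A then f else 0)"

lemma subspace_simple_dual: "subspace simple_dual"
proof (rule subspaceI)
  show "0 \<in> simple_dual"
    using simple_function_const[of I01 "0 :: 'a \<Rightarrow> real"] subspace_0[OF subspace_fdual]
    by (simp add: simple_dual_def zero_fun_def)
  show "\<phi> + \<psi> \<in> simple_dual" if "\<phi> \<in> simple_dual" "\<psi> \<in> simple_dual" for \<phi> \<psi>
    using that simple_function_compose2[of I01 \<phi> \<psi> "(+)"] subspace_add[OF subspace_fdual]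
    by (simp add: simple_dual_def plus_fun_def[of \<phi>])
  show "c *\<^sub>R \<phi> \<in> simple_dual" if "\<phi> \<in> simple_dual" for c \<phi>
    using that simple_function_compose1[of I01 \<phi> "(*\<^sub>R) c"] subspace_scale[OF subspace_fdual]
    by (simp add: simple_dual_def scaleR_fun_def[of c \<phi>])
qed

lemma cut_in_simple_dual:
  assumes A: "A \<in> sets I01" and f: "f \<in> fdual p"
  shows "cut A f \<in> simple_dual"
proof -
  have "simple_function I01 (\<lambda>t. if (indicator A t :: nat) = 1 then f else 0)"
    by (rule simple_function_compose1[OF simple_function_indicator[OF A], of "\<lambda>n. if n = 1 then f else 0"])
  moreover have "(\<lambda>t. if (indicator A t :: nat) = 1 then f else 0) = cut A f"
    by (auto simp: cut_def fun_eq_iff)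
  ultimately show ?thesis using f subspace_0[OF subspace_fdual] by (simp add: simple_dual_def cut_def)
qed

lemma cut_add: "cut A f + cut A g = cut A (f + g)"
  and cut_scale: "c *\<^sub>R cut A f = cut A (c *\<^sub>R f)"
  by (auto simp: cut_def fun_eq_iff)

lemma cut_Un: "A \<inter> B = {} \<Longrightarrow> cut (A \<union> B) f = cut A f + cut B f"
  by (auto simp: cut_def fun_eq_iff)

text \<open>\<open>\<phi>\<close> has finitely many values, so the integrand is a finite sum of
  scalar support functions restricted to measurable sets.\<close>

lemma simple_dual_integrable:
  assumes \<phi>: "\<phi> \<in> simple_dual"
  shows "integrable I01 (\<lambda>t. supp_fun (\<phi> t) (\<Gamma> t))"
proof -
  have s: "simple_function I01 \<phi>" and dual: "\<And>t. \<phi> t \<in> fdual p" using \<phi> by (auto simp: simple_dual_def)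
  let ?A = "\<lambda>f. \<phi> -` {f} \<inter> space I01"
  have int: "integrable I01 (\<lambda>t. \<Sum>f\<in>\<phi> ` space I01. indicator (?A f) t *\<^sub>R supp_fun f (\<Gamma> t))"
    using dual
    by (intro Bochner_Integration.integrable_sum integrable_mult_indicator simple_functionD(2)[OF s])
      (auto intro: supp_integrable)
  have eq: "(\<Sum>f\<in>\<phi> ` space I01. indicator (?A f) t *\<^sub>R supp_fun f (\<Gamma> t)) = supp_fun (\<phi> t) (\<Gamma> t)"
    if t: "t \<in> space I01" for t
  proof -
    have "(\<Sum>f\<in>\<phi> ` space I01. indicator (?A f) t *\<^sub>R supp_fun f (\<Gamma> t))
        = (\<Sum>f\<in>{\<phi> t}. indicator (?A f) t *\<^sub>R supp_fun f (\<Gamma> t))"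
      using t simple_functionD(1)[OF s] by (intro sum.mono_neutral_right) auto
    also have "\<dots> = supp_fun (\<phi> t) (\<Gamma> t)" using t by simp
    finally show ?thesis .
  qed
  show ?thesis by (rule iffD1[OF Bochner_Integration.integrable_cong[OF refl eq] int])
qed

lemma supp_int_cut:
  assumes "f \<in> fdual p"
  shows "supp_int (cut A f) = (LINT t:A|I01. supp_fun f (\<Gamma> t))"
  unfolding supp_int_def set_lebesgue_integral_def
  by (intro Bochner_Integration.integral_cong refl) (auto simp: cut_def supp_zero ck split: split_indicator)

lemma sublinear_supp_int: "sublinear_on simple_dual supp_int"
  unfolding sublinear_on_def
proof (intro conjI ballI allI impI)
  fix \<phi> \<psi> assume \<phi>: "\<phi> \<in> simple_dual" and \<psi>: "\<psi> \<in> simple_dual"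
  have "supp_int (\<phi> + \<psi>) \<le> (LINT t|I01. supp_fun (\<phi> t) (\<Gamma> t) + supp_fun (\<psi> t) (\<Gamma> t))"
    unfolding supp_int_def
  proof (rule integral_mono)
    show "integrable I01 (\<lambda>t. supp_fun ((\<phi> + \<psi>) t) (\<Gamma> t))"
      by (intro simple_dual_integrable subspace_add subspace_simple_dual \<phi> \<psi>)
    show "integrable I01 (\<lambda>t. supp_fun (\<phi> t) (\<Gamma> t) + supp_fun (\<psi> t) (\<Gamma> t))"
      by (intro Bochner_Integration.integrable_add simple_dual_integrable \<phi> \<psi>)
    show "supp_fun ((\<phi> + \<psi>) t) (\<Gamma> t) \<le> supp_fun (\<phi> t) (\<Gamma> t) + supp_fun (\<psi> t) (\<Gamma> t)"
      if "t \<in> space I01" for t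
      using that \<phi> \<psi> supp_add[OF ck] by (simp add: simple_dual_def)
  qed
  also have "\<dots> = supp_int \<phi> + supp_int \<psi>"
    unfolding supp_int_def
    by (intro Bochner_Integration.integral_add simple_dual_integrable \<phi> \<psi>)
  finally show "supp_int (\<phi> + \<psi>) \<le> supp_int \<phi> + supp_int \<psi>" .
next
  fix c :: real and \<phi> assume c: "0 \<le> c" and \<phi>: "\<phi> \<in> simple_dual"
  have "supp_int (c *\<^sub>R \<phi>) = (LINT t|I01. c * supp_fun (\<phi> t) (\<Gamma> t))"
    unfolding supp_int_def
    using \<phi> c by (intro Bochner_Integration.integral_cong refl) (simp add: simple_dual_def supp_scale ck)
  then show "supp_int (c *\<^sub>R \<phi>) = c * supp_int \<phi>" by (simp add: supp_int_def)
qed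

text \<open>Hahn--Banach on the simple \<open>X\<^sup>*\<close>-valued functions plays the role of choosing an additive selector
  \<open>A \<mapsto> \<nu> A \<in> (P)\<integral>\<^sub>A \<Gamma>\<close> with \<open>\<nu> E = y\<close>: the functional \<open>\<Phi>\<close> is \<open>\<Phi> (\<chi>\<^sub>A f) = f (\<nu> A)\<close>.\<close>

lemma dominated_functional_through:
  assumes E: "E \<in> sets I01" and K: "is_pettis_int_mf p \<Gamma> E K" and y: "y \<in> K"
  obtains \<Phi> where "linear_on simple_dual \<Phi>" "\<And>\<phi>. \<phi> \<in> simple_dual \<Longrightarrow> \<Phi> \<phi> \<le> supp_int \<phi>"
    "\<And>f. f \<in> fdual p \<Longrightarrow> \<Phi> (cut E f) = f y"
proof -
  have "K \<in> ck p" using K by (simp add: is_pettis_int_mf_def)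
  \<comment> \<open>The demands form a linear subspace: used for \<open>f\<close> and for
    \<open>- f\<close>, the lower bounds become the equality
    \<open>\<Phi> (cut E f) = f y\<close>.\<close>
  let ?P = "(\<lambda>f. (cut E f, f y)) ` fdual p"
  interpret dominated_cone simple_dual supp_int ?P
  proof
    have "(cut E 0, 0) = (0 :: (real \<Rightarrow> 'a \<Rightarrow> real) \<times> real)" by (auto simp: cut_def zero_prod_def fun_eq_iff)
    then show "0 \<in> ?P" using subspace_0[OF subspace_fdual] by (force simp: image_iff)
    show "w + w' \<in> ?P" if "w \<in> ?P" "w' \<in> ?P" for w w'
      using that by (auto simp: cut_add image_iff intro!: bexI[of _ "_ + _"] subspace_add subspace_fdual)
    show "c *\<^sub>R w \<in> ?P" if "w \<in> ?P" "0 < c" for w c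
      using that by (auto simp: cut_scale image_iff intro!: bexI[of _ "c *\<^sub>R _"] subspace_scale subspace_fdual)
    show "snd w \<le> supp_int (fst w)" if "w \<in> ?P" for w
      using that supp_upper[OF \<open>K \<in> ck p\<close> _ y] supp_integral[OF E K]
      by (auto simp: supp_int_cut)
  qed (auto simp: subspace_simple_dual sublinear_supp_int cut_in_simple_dual E)
  obtain \<Phi> where \<Phi>: "linear_on simple_dual \<Phi>" "\<And>\<phi>. \<phi> \<in> simple_dual \<Longrightarrow> \<Phi> \<phi> \<le> supp_int \<phi>"
    "\<And>w. w \<in> ?P \<Longrightarrow> snd w \<le> \<Phi> (fst w)"
    by (rule Mazur_Orlicz) blast
  have ge: "f y \<le> \<Phi> (cut E f)" if "f \<in> fdual p" for f
    using \<Phi>(3)[OF imageI[OF that]] by simp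
  have "\<Phi> (cut E f) = f y" if f: "f \<in> fdual p" for f
  proof -
    have "\<Phi> ((- 1) *\<^sub>R cut E f) = (- 1) * \<Phi> (cut E f)"
      using \<Phi>(1) cut_in_simple_dual[OF E f] unfolding linear_on_def by blast
    then have "\<Phi> (cut E ((- 1) *\<^sub>R f)) = - \<Phi> (cut E f)" unfolding cut_scale by simp
    then show ?thesis
      using ge[OF subspace_scale[OF subspace_fdual f, of "- 1"]] ge[OF f] by simp
  qed
  with \<Phi>(1,2) that show ?thesis by blast
qed

section \<open>Densities of a dominated functional and the selection they determine\<close>

context
  fixes \<Phi> :: "(real \<Rightarrow> 'a \<Rightarrow> real) \<Rightarrow> real"
  assumes lin: "linear_on simple_dual \<Phi>" and dom: "\<And>\<phi>. \<phi> \<in> simple_dual \<Longrightarrow> \<Phi> \<phi> \<le> supp_int \<phi>"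
begin

lemma linear_on_cut:
  assumes A: "A \<in> sets I01" shows "linear_on (fdual p) (\<lambda>f. \<Phi> (cut A f))"
  using lin cut_in_simple_dual[OF A] unfolding linear_on_def
  by (simp flip: cut_add cut_scale)

lemma cut_dominated:
  "A \<in> sets I01 \<Longrightarrow> f \<in> fdual p \<Longrightarrow> \<Phi> (cut A f) \<le> (LINT t:A|I01. supp_fun f (\<Gamma> t))"
  using dom[OF cut_in_simple_dual] by (simp add: supp_int_cut)

text \<open>The gap between the integral of the support function and \<open>\<Phi> (cut A f)\<close>
  is a nonnegative additive set function. Domination at \<open>- f\<close> bounds it by the integral
  of the support functions of \<open>f\<close> and \<open>- f\<close>, so it has a density, which is
  then subtracted.\<close>

lemma density:
  assumes f: "f \<in> fdual p"
  shows "\<exists>g. integrable I01 g \<and> (\<forall>A\<in>sets I01. \<Phi> (cut A f) = (LINT t:A|I01. g t))"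
proof -
  let ?s = "\<lambda>t. supp_fun f (\<Gamma> t)"
  have f': "(- 1) *\<^sub>R f \<in> fdual p" using f by (intro subspace_scale subspace_fdual)
  have neg: "\<Phi> (cut A ((- 1) *\<^sub>R f)) = - \<Phi> (cut A f)" if "A \<in> sets I01" for A
  proof -
    have "\<Phi> (cut A ((- 1) *\<^sub>R f)) = (- 1) * \<Phi> (cut A f)"
      using linear_on_cut[OF that] f unfolding linear_on_def by blast
    then show ?thesis by simp
  qed
  obtain h where h: "integrable I01 h"
      "\<And>A. A \<in> sets I01 \<Longrightarrow> (LINT t:A|I01. ?s t) - \<Phi> (cut A f) = (LINT t:A|I01. h t)"
  proof (rule dominated_additive_density[where M = I01
        and \<mu> = "\<lambda>A. (LINT t:A|I01. ?s t) - \<Phi> (cut A f)" and w = "\<lambda>t. ?s t + supp_fun ((- 1) *\<^sub>R f) (\<Gamma> t)"])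
    show "finite_measure I01" by (intro finite_measure_lebesgue_on) simp
    show "integrable I01 (\<lambda>t. ?s t + supp_fun ((- 1) *\<^sub>R f) (\<Gamma> t))"
      by (intro Bochner_Integration.integrable_add supp_integrable f f')
    show "0 \<le> (LINT t:A|I01. ?s t) - \<Phi> (cut A f)" if "A \<in> sets I01" for A
      using cut_dominated[OF that f] by simp
    show "(LINT t:A|I01. ?s t) - \<Phi> (cut A f) \<le> (LINT t:A|I01. ?s t + supp_fun ((- 1) *\<^sub>R f) (\<Gamma> t))"
      if A: "A \<in> sets I01" for A
      using cut_dominated[OF A f'] neg[OF A]
        set_integral_add(2)[OF supp_set_integrable[OF f A] supp_set_integrable[OF f' A]] by linarith
    show "(LINT t:A \<union> B|I01. ?s t) - \<Phi> (cut (A \<union> B) f)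
        = (LINT t:A|I01. ?s t) - \<Phi> (cut A f) + ((LINT t:B|I01. ?s t) - \<Phi> (cut B f))"
      if A: "A \<in> sets I01" and B: "B \<in> sets I01" and disj: "A \<inter> B = {}" for A B
    proof -
      have "\<Phi> (cut (A \<union> B) f) = \<Phi> (cut A f) + \<Phi> (cut B f)"
        using lin cut_in_simple_dual[OF A f] cut_in_simple_dual[OF B f]
        by (simp add: cut_Un[OF disj] linear_on_def)
      then show ?thesis
        using set_integral_Un[OF disj supp_set_integrable[OF f A] supp_set_integrable[OF f B]] by simp
    qed
  qed blast
  have "\<Phi> (cut A f) = (LINT t:A|I01. ?s t - h t)" if A: "A \<in> sets I01" for A
    using set_integral_diff(2)[OF supp_set_integrable[OF f A] integrable_imp_set_integrable[OF h(1) A]]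
      h(2)[OF A] by linarith
  moreover have "integrable I01 (\<lambda>t. ?s t - h t)"
    by (intro Bochner_Integration.integrable_diff supp_integrable f h(1))
  ultimately show ?thesis by blast
qed

text \<open>For one integer combination, linearity turns the integral of the left side over
  \<open>A\<close> into \<open>\<Phi>\<close> of a single cut, which is dominated; as
  \<open>A\<close> is arbitrary, the inequality holds almost everywhere. Integer lists are
  countable, so the null sets unite to a null set.\<close>

lemma density_interpolates:
  assumes g: "\<And>f. f \<in> fdual p \<Longrightarrow> integrable I01 (g f)"
      "\<And>f A. f \<in> fdual p \<Longrightarrow> A \<in> sets I01 \<Longrightarrow> \<Phi> (cut A f) = (LINT t:A|I01. g f t)"
    and e: "\<And>i. e i \<in> fdual p"
  shows "AE t in I01. interpolates e (\<lambda>i. g (e i) t) (\<Gamma> t)"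
  unfolding interpolates_def AE_all_countable
proof
  fix c :: "int list"
  let ?f = "\<Sum>i<length c. real_of_int (c ! i) *\<^sub>R e i"
  have f: "?f \<in> fdual p" by (intro dual_combination e)
  show "AE t in I01. (\<Sum>i<length c. real_of_int (c ! i) * g (e i) t) \<le> supp_fun ?f (\<Gamma> t)"
  proof (rule AE_le_if_set_integral_le)
    show "integrable I01 (\<lambda>t. \<Sum>i<length c. real_of_int (c ! i) * g (e i) t)"
      by (intro Bochner_Integration.integrable_sum integrable_mult_right g(1) e)
    show "integrable I01 (\<lambda>t. supp_fun ?f (\<Gamma> t))" by (rule supp_integrable[OF f])
    fix A assume A: "A \<in> sets I01"
    have "(LINT t:A|I01. (\<Sum>i<length c. real_of_int (c ! i) * g (e i) t))
        = (LINT t|I01. (\<Sum>i<length c. real_of_int (c ! i) * (indicator A t *\<^sub>R g (e i) t)))"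
      unfolding set_lebesgue_integral_def
      by (intro Bochner_Integration.integral_cong refl) (simp add: sum_distrib_left mult_ac)
    also have "\<dots> = (\<Sum>i<length c. real_of_int (c ! i) * (LINT t:A|I01. g (e i) t))"
      unfolding set_lebesgue_integral_def
      by (subst Bochner_Integration.integral_sum[OF integrable_mult_right[OF
              integrable_mult_indicator[OF A g(1)[OF e]]]])
        (simp only: integral_mult_right_zero)
    also have "\<dots> = (\<Sum>i<length c. real_of_int (c ! i) * \<Phi> (cut A (e i)))"
      using g(2)[OF e A] by simp
    also have "\<dots> = \<Phi> (cut A ?f)"
      using linear_on_combination[OF subspace_fdual linear_on_cut[OF A], of "{..<length c}" e] e by simp
    also have "\<dots> \<le> (LINT t:A|I01. supp_fun ?f (\<Gamma> t))" by (rule cut_dominated[OF A f])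
    finally show "(LINT t:A|I01. (\<Sum>i<length c. real_of_int (c ! i) * g (e i) t))
        \<le> (LINT t:A|I01. supp_fun ?f (\<Gamma> t))" .
  qed
qed

text \<open>The selection is determined by a countable separating family \<open>d\<close>. Repeating the interpolation
  with one further functional \<open>f\<close> must produce the same points, which identifies \<open>f \<circ> s\<close> with the
  density of \<open>f\<close>.\<close>

lemma selection_of_densities:
  assumes Z: "countable Z" "AE t in I01. \<forall>x\<in>\<Gamma> t. approximable Z x"
  obtains s where "selection \<Gamma> s" "\<And>f. f \<in> fdual p \<Longrightarrow> integrable I01 (\<lambda>t. f (s t))"
    "\<And>f A. f \<in> fdual p \<Longrightarrow> A \<in> sets I01 \<Longrightarrow> \<Phi> (cut A f) = (LINT t:A|I01. f (s t))"
proof -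
  have "\<forall>f\<in>fdual p. \<exists>g. integrable I01 g \<and> (\<forall>A\<in>sets I01. \<Phi> (cut A f) = (LINT t:A|I01. g t))"
    using density by blast
  from bchoice[OF this] obtain g
    where "\<forall>f\<in>fdual p. integrable I01 (g f) \<and> (\<forall>A\<in>sets I01. \<Phi> (cut A f) = (LINT t:A|I01. g f t))"
    by (rule exE)
  then have g: "\<And>f. f \<in> fdual p \<Longrightarrow> integrable I01 (g f)"
      "\<And>f A. f \<in> fdual p \<Longrightarrow> A \<in> sets I01 \<Longrightarrow> \<Phi> (cut A f) = (LINT t:A|I01. g f t)"
    by auto
  obtain d :: "nat \<Rightarrow> 'a \<Rightarrow> real" where d: "\<And>i. d i \<in> fdual p"
      and sep: "\<And>u v. approximable Z u \<Longrightarrow> approximable Z v \<Longrightarrow> (\<And>i. d i u = d i v) \<Longrightarrow> u = v"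
    by (rule countable_separating[OF Z(1)]) blast
  have ex: "AE t in I01. \<exists>z\<in>\<Gamma> t. \<forall>i. e i z = g (e i) t" if e: "\<And>i. e i \<in> fdual p" for e :: "nat \<Rightarrow> 'a \<Rightarrow> real"
  proof -
    have "AE t in I01. interpolates e (\<lambda>i. g (e i) t) (\<Gamma> t)"
      using g e by (rule density_interpolates)
    then show ?thesis using AE_space
    proof eventually_elim
      case (elim t)
      then have "\<Gamma> t \<in> ck p" using ck by simp
      from this e elim(1) show ?case by (rule interpolation) blast
    qed
  qed
  \<comment> \<open>A pointwise choice without regard to measurability; its value is arbitrary on
    the null set where no such point exists.\<close>
  define s where "s t = (SOME z. z \<in> \<Gamma> t \<and> (\<forall>i. d i z = g (d i) t))" for t
  have s: "AE t in I01. s t \<in> \<Gamma> t \<and> (\<forall>i. d i (s t) = g (d i) t)"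
    using ex[of d, OF d]
  proof eventually_elim
    case (elim t)
    then have "\<exists>z. z \<in> \<Gamma> t \<and> (\<forall>i. d i z = g (d i) t)" by blast
    then show ?case unfolding s_def by (rule someI_ex)
  qed
  have eq: "AE t in I01. f (s t) = g f t" if f: "f \<in> fdual p" for f
  proof -
    have "case_nat f d i \<in> fdual p" for i using d f by (cases i) auto
    then have "AE t in I01. \<exists>z\<in>\<Gamma> t. \<forall>i. case_nat f d i z = g (case_nat f d i) t" by (rule ex)
    then show ?thesis using s Z(2)
    proof eventually_elim
      case (elim t)
      then obtain z where z: "z \<in> \<Gamma> t" "\<forall>i. case_nat f d i z = g (case_nat f d i) t" by blast
      have "d i z = d i (s t)" for i using spec[OF z(2), of "Suc i"] elim(2) by simp
      then have "z = s t" using elim(2,3) z(1) sep by blast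
      then show ?case using spec[OF z(2), of 0] by simp
    qed
  qed
  interpret complete_measure I01 by (rule complete_measure_lebesgue_on) simp
  have meas: "(\<lambda>t. f (s t)) \<in> borel_measurable I01" if f: "f \<in> fdual p" for f
    by (rule borel_measurable_if_AE_eq[OF _ eq[OF f]]) (use g(1)[OF f] in simp)
  show ?thesis
  proof
    show "selection \<Gamma> s" unfolding selection_def using s by eventually_elim simp
    fix f assume f: "f \<in> fdual p"
    show "integrable I01 (\<lambda>t. f (s t))"
      using g(1)[OF f] meas[OF f] by (rule integrable_cong_AE_imp) (use eq[OF f] in eventually_elim, simp)
    fix A assume A: "A \<in> sets I01"
    have "(LINT t:A|I01. f (s t)) = (LINT t:A|I01. g f t)"
      unfolding set_lebesgue_integral_def using A meas[OF f] g(1)[OF f] eq[OF f]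
      by (intro integral_cong_AE) (auto elim!: eventually_mono)
    then show "\<Phi> (cut A f) = (LINT t:A|I01. f (s t))" using g(2)[OF f A] by simp
  qed
qed

end

section \<open>The two inclusions\<close>

lemma integral_mem_Pettis_integral:
  assumes E: "E \<in> sets I01" and K: "is_pettis_int_mf p \<Gamma> E K"
    and f: "selection \<Gamma> f" "pettis_integrable p f" "is_pettis_int p f E y"
  shows "y \<in> K"
proof (rule mem_if_dominated_by_supp)
  show "K \<in> ck p" using K by (simp add: is_pettis_int_mf_def)
  fix x assume x: "x \<in> fdual p"
  have int: "integrable I01 (\<lambda>t. x (f t))" using f(2) x by (auto simp: pettis_integrable_def)
  have "AE t in I01. x (f t) \<le> supp_fun x (\<Gamma> t)"
    using f(1)[unfolded selection_def] AE_space
    by eventually_elim (use ck supp_upper x in auto)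
  then have "(LINT t:E|I01. x (f t)) \<le> (LINT t:E|I01. supp_fun x (\<Gamma> t))"
    using int x E by (intro set_integral_mono_AE integrable_imp_set_integrable supp_integrable) auto
  then show "x y \<le> supp_fun x K"
    using f(3) x supp_integral[OF E K x] integral_lebesgue_on_eq_set_integral[OF E]
    by (simp add: is_pettis_int_def)
qed

lemma exists_selection_with_integral:
  assumes B: "bochner_meas_mf p \<Gamma>" and E: "E \<in> sets I01" and K: "is_pettis_int_mf p \<Gamma> E K" and y: "y \<in> K"
  shows "\<exists>f. selection \<Gamma> f \<and> pettis_integrable p f \<and> is_pettis_int p f E y"
proof -
  obtain Z where Z: "countable Z" "AE t in I01. \<forall>x\<in>\<Gamma> t. approximable Z x"
    using ck B by (rule Bochner_measurable_separable)
  obtain \<Phi> where lin: "linear_on simple_dual \<Phi>" and dom: "\<And>\<phi>. \<phi> \<in> simple_dual \<Longrightarrow> \<Phi> \<phi> \<le> supp_int \<phi>"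
    and \<Phi>E: "\<And>f. f \<in> fdual p \<Longrightarrow> \<Phi> (cut E f) = f y"
    using E K y by (rule dominated_functional_through) blast
  obtain s where s: "selection \<Gamma> s" "\<And>f. f \<in> fdual p \<Longrightarrow> integrable I01 (\<lambda>t. f (s t))"
    "\<And>f A. f \<in> fdual p \<Longrightarrow> A \<in> sets I01 \<Longrightarrow> \<Phi> (cut A f) = (LINT t:A|I01. f (s t))"
    by (rule selection_of_densities[OF lin dom Z]; (assumption | rule that, simp_all))
  \<comment> \<open>Only the integral over \<open>E\<close> is prescribed. Over a general
    \<open>A\<close> it is the point of \<open>K'\<close> that represents
    \<open>\<Phi> (cut A f)\<close> as a functional of \<open>f\<close>.\<close>
  have "\<exists>z. is_pettis_int p s A z" if A: "A \<in> sets I01" for A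
  proof -
    obtain K' where K': "is_pettis_int_mf p \<Gamma> A K'"
      using pettis A unfolding pettis_integrable_mf_def by blast
    have le: "\<Phi> (cut A f) \<le> supp_fun f K'" if "f \<in> fdual p" for f
      using cut_dominated[OF lin dom A that] supp_integral[OF A K' that] by simp
    have L: "linear_on (fdual p) (\<lambda>f. \<Phi> (cut A f))"
      using lin dom A by (rule linear_on_cut)
    have "\<exists>z. \<forall>f\<in>fdual p. \<Phi> (cut A f) = f z"
    proof (rule represent_linear_functional[OF _ L])
      show "K' \<in> ck p" using K' by (simp add: is_pettis_int_mf_def)
      show "\<Phi> (cut A f) \<le> supp_fun f K'" if "f \<in> fdual p" for f
        using that by (rule le)
      fix z assume "\<And>f. f \<in> fdual p \<Longrightarrow> \<Phi> (cut A f) = f z"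
      then show "\<exists>z. \<forall>f\<in>fdual p. \<Phi> (cut A f) = f z" by (intro exI[of _ z] ballI)
    qed
    then show ?thesis
      using s(3)[OF _ A] integral_lebesgue_on_eq_set_integral[OF A]
      by (auto simp: is_pettis_int_def)
  qed
  then have "pettis_integrable p s" using s(2) by (simp add: pettis_integrable_def)
  moreover have "is_pettis_int p s E y"
    using s(3)[OF _ E] \<Phi>E integral_lebesgue_on_eq_set_integral[OF E] by (simp add: is_pettis_int_def)
  ultimately show ?thesis using s(1) by blast
qed

end

theorem theorem4p11:
  fixes p :: "nat \<Rightarrow> 'a::real_vector \<Rightarrow> real"
    and \<Gamma> :: "real \<Rightarrow> 'a set"
    and E :: "real set" and K :: "'a set"
  assumes "frechet p"
    and "\<forall>t\<in>{0..1}. \<Gamma> t \<in> ck p"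
    and "bochner_meas_mf p \<Gamma>"
    and "pettis_integrable_mf p \<Gamma>"
    and "E \<in> sets (lebesgue_on {0..1})"
    and "is_pettis_int_mf p \<Gamma> E K"
  shows "K = {y. \<exists>f. selection \<Gamma> f \<and> pettis_integrable p f \<and> is_pettis_int p f E y}"
proof -
  interpret pettis_multifunction p \<Gamma>
    using assms(1,2,4) by unfold_locales auto
  show ?thesis
    using exists_selection_with_integral[OF assms(3,5,6)] integral_mem_Pettis_integral[OF assms(5,6)]
    by blast
qed

end
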